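(* Let $g:\mathbb{R}\to\mathbb{R}$ be a derivator with $\infty\notin N_g^+$, let $\mathbb{F}\in\{\mathbb{R},\mathbb{C}\}$, fix $x_0\in\mathbb{R}$, and write $g_n=g_{x_0,n}$ for the $g$-monomials centered at $x_0$. Let $m\in\mathbb{N}$, $m\ge 1$, let $\lambda_0,\dots,\lambda_{m-1},c_0,\dots,c_{m-1}\in\mathbb{F}$ and let $\{r_n\}_{n\ge 0}\subset\mathbb{R}$. Let $\{a_n\}_{n\ge 0}\subset\mathbb{F}$ be the solution of $$a_{n+m}(n+m)!=\sum_{k=0}^{m-1}\lambda_k\,a_{n+k}(n+k)!+r_n n!\quad (n\ge 0),\qquad a_k\,k!=c_k\quad (k\in\{0,\dots,m-1\}).$$ Assume that $$f(x)=\sum_{n=0}^\infty r_n g_n(x)$$ converges absolutely on $[x_0,c]$ for some $c>x_0$, and suppose $x_0\notin N_g^-$ and $c\notin D_g\cup N_g^+\cup C_g$. Then $$v(x)=\sum_{n=0}^\infty a_n g_n(x)$$ converges absolutely on $[x_0,c]$, $v\in\mathcal{C}^m_g([x_0,c],\mathbb{F})$, and $v$ solves on $[x_0,c]$ the problem $$v^{(m)}_g(x)=\sum_{k=0}^{m-1}\lambda_k v^{(k)}_g(x)+f(x),\qquad v^{(k)}_g(x_0)=c_k,\quad k\in\{0,\dots,m-1\}.$$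
   Context: A derivator is a left-continuous non-decreasing function $g:\mathbb{R}\to\mathbb{R}$. $\mu_g$ denotes its Lebesgue–Stieltjes measure, characterized on Borel sets by $\mu_g([a,b))=g(b)-g(a)$ for $a<b$. $g$-monomials centered at $x_0$: $g_{x_0,0}\equiv 1$ and, for $n\ge 1$, $g_{x_0,n}(x)=n\int_{[x_0,x)}g_{x_0,n-1}\,d\mu_g$ if $x\ge x_0$ and $g_{x_0,n}(x)=-n\int_{[x,x_0)}g_{x_0,n-1}\,d\mu_g$ if $x<x_0$. Put $\Delta g(x)=g(x^+)-g(x)$, $D_g=\{x:\Delta g(x)>0\}$, $C_g=\{x: g$ is constant on $(x-\varepsilon,x+\varepsilon)$ for some $\varepsilon>0\}$. Write the open set $C_g$ as the disjoint union of its connected components $(a_n,b_n)$, $n\in\Lambda\subset\mathbb N$ (with $a_n,b_n\in\mathbb{R}\cup\{\pm\infty\}$). Set $N_g^-=\{a_n\}_{n\in\Lambda}\setminus D_g$, $N_g^+=\{b_n\}_{n\in\Lambda}\setminus D_g$ (these $a_n,b_n$ are unrelated to the coefficients $a_n$ in the claim). $g$-derivative on an interval: let $a<b$ with $a\notin N_g^-$, $b\notin D_g\cup N_g^+\cup C_g$. For $f:[a,b]\to\mathbb{F}$ and $x\in[a,b]$ (when the limit exists): $f'_g(x)=\lim_{y\to x^+}\frac{f(y)-f(x)}{g(y)-g(x)}$ if $x\in D_g$; $f'_g(x)=\lim_{y\to x}\frac{f(y)-f(x)}{g(y)-g(x)}$ if $x\notin D_g\cup C_g$, where the limit is taken only from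 the right if $x\in N_g^+$ and only from the left if $x\in N_g^-$ (and from inside $[a,b]$ at endpoints); $f'_g(x)=\lim_{y\to b_n^+}\frac{f(y)-f(b_n)}{g(y)-g(b_n)}$ if $x\in(a_n,b_n)$, a component of $C_g$. $v_g^{(k)}$ denotes the $k$-th iterated $g$-derivative, $v^{(0)}_g=v$. $f$ is $g$-continuous at $x$ if for every $\varepsilon>0$ there is $\delta>0$ such that $|f(y)-f(x)|<\varepsilon$ for all $y$ in the domain with $|g(y)-g(x)|<\delta$. $\mathcal{C}^1_g([a,b],\mathbb{F})$ is the set of $g$-continuous $f:[a,b]\to\mathbb{F}$ whose $g$-derivative exists at every point of $[a,b]$ and is $g$-continuous; recursively $f\in\mathcal{C}^k_g$ if $f$ is $g$-continuous, $f'_g$ exists everywhere on $[a,b]$ and $f'_g\in\mathcal{C}^{k-1}_g$. *)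

theory Defs
  imports "HOL-Analysis.Analysis"
begin

definition derivator :: "(real \<Rightarrow> real) \<Rightarrow> bool" where
  "derivator g \<longleftrightarrow> mono g \<and> (\<forall>x. continuous (at_left x) g)"

text \<open>
  \<^const>\<open>interval_measure\<close> is made for right-continuous functions and half-open intervals
  \<open>{a<..b}\<close>. For a left-continuous \<open>g\<close> we apply it to the reflected function \<open>x \<mapsto> - g (- x)\<close>
  and reflect the measure back; \<open>emeasure_stieltjes\<close> below is the characterisation on \<open>{a..<b}\<close>.
\<close>
definition stieltjes :: "(real \<Rightarrow> real) \<Rightarrow> real measure" where
  "stieltjes g = distr (interval_measure (\<lambda>x. - g (- x))) borel uminus"

lemma sets_stieltjes [simp, measurable_cong]: "sets (stieltjes g) = sets borel"
  by (simp add: stieltjes_def)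

lemma emeasure_stieltjes:
  assumes "derivator g" "a < b"
  shows "emeasure (stieltjes g) {a..<b} = ennreal (g b - g a)"
proof -
  have mono: "mono g" and cont: "\<And>x. continuous (at_left x) g"
    using assms(1) by (auto simp: derivator_def)
  have rc: "continuous (at_right x) (\<lambda>x. - g (- x))" for x
  proof -
    have "(g \<longlongrightarrow> g (- x)) (at_left (- x))"
      using cont[of "- x"] by (simp add: continuous_within)
    then have "((\<lambda>y. g (- y)) \<longlongrightarrow> g (- x)) (at_right x)"
      by (simp add: at_left_minus filterlim_filtermap)
    then show ?thesis
      by (simp add: continuous_within tendsto_minus)
  qed
  have pre: "uminus -` {a..<b} = {- b<..- a}"
    by auto
  have "emeasure (stieltjes g) {a..<b}
      = emeasure (interval_measure (\<lambda>x. - g (- x))) {- b<..- a}"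
    unfolding stieltjes_def by (subst emeasure_distr) (auto simp: pre)
  also have "\<dots> = ennreal (g b - g a)"
    using assms(2) rc mono
    by (subst emeasure_interval_measure_Ioc) (auto intro: monoD)
  finally show ?thesis .
qed

primrec g_monomial :: "(real \<Rightarrow> real) \<Rightarrow> real \<Rightarrow> nat \<Rightarrow> real \<Rightarrow> real" where
  "g_monomial g x0 0 = (\<lambda>x. 1)"
| "g_monomial g x0 (Suc n) = (\<lambda>x.
     if x0 \<le> x
     then real (Suc n) * (LINT t:{x0..<x}|stieltjes g. g_monomial g x0 n t)
     else - real (Suc n) * (LINT t:{x..<x0}|stieltjes g. g_monomial g x0 n t))"

definition jump :: "(real \<Rightarrow> real) \<Rightarrow> real \<Rightarrow> real" where
  "jump g x = Lim (at_right x) g - g x"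

definition D_set :: "(real \<Rightarrow> real) \<Rightarrow> real set" where
  "D_set g = {x. jump g x > 0}"

definition C_set :: "(real \<Rightarrow> real) \<Rightarrow> real set" where
  "C_set g = {x. \<exists>\<epsilon>>0. g constant_on {x - \<epsilon><..<x + \<epsilon>}}"

text \<open>
  The left and right endpoints of the connected components of \<^term>\<open>C_set g\<close> may be infinite,
  hence are taken in \<^typ>\<open>ereal\<close>.
\<close>
definition N_minus :: "(real \<Rightarrow> real) \<Rightarrow> ereal set" where
  "N_minus g = {Inf (ereal ` K) | K. K \<in> components (C_set g)} - ereal ` D_set g"

definition N_plus :: "(real \<Rightarrow> real) \<Rightarrow> ereal set" where
  "N_plus g = {Sup (ereal ` K) | K. K \<in> components (C_set g)} - ereal ` D_set g"

text \<open>
  For \<open>x\<close> in a component \<open>(a\<^sub>n, b\<^sub>n)\<close> of \<^term>\<open>C_set g\<close> the \<open>g\<close>-derivative at \<open>x\<close> is a limit at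
  \<open>b\<^sub>n\<close>; otherwise it is a limit at \<open>x\<close> itself. When \<open>b \<notin> C_set g\<close>, each component meeting
  \<open>{a..b}\<close> is bounded above, so the real-valued supremum is the true endpoint.
\<close>
definition g_base :: "(real \<Rightarrow> real) \<Rightarrow> real \<Rightarrow> real" where
  "g_base g x = (if x \<in> C_set g then Sup (connected_component_set (C_set g) x) else x)"

text \<open>
  Intersecting with \<open>{a..b}\<close> expresses that functions live on \<open>{a..b}\<close> only; it matters solely
  for the one-sided limits at the endpoints. For a derivator \<^term>\<open>D_set g\<close> and
  \<^term>\<open>C_set g\<close> are disjoint, so \<open>g_base g x = x\<close> when \<open>x \<in> D_set g\<close>.
\<close>
definition g_filter :: "(real \<Rightarrow> real) \<Rightarrow> real \<Rightarrow> real \<Rightarrow> real \<Rightarrow> real filter" where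
  "g_filter g a b x =
     (if x \<in> D_set g \<union> C_set g then at (g_base g x) within {a..b} \<inter> {g_base g x<..}
      else if ereal x \<in> N_plus g then at x within {a..b} \<inter> {x<..}
      else if ereal x \<in> N_minus g then at x within {a..b} \<inter> {..<x}
      else at x within {a..b})"

definition g_quotient ::
    "(real \<Rightarrow> real) \<Rightarrow> (real \<Rightarrow> 'a::real_normed_field) \<Rightarrow> real \<Rightarrow> real \<Rightarrow> 'a" where
  "g_quotient g f x y = (f y - f (g_base g x)) / of_real (g y - g (g_base g x))"

definition g_differentiable ::
    "(real \<Rightarrow> real) \<Rightarrow> real \<Rightarrow> real \<Rightarrow> (real \<Rightarrow> 'a::real_normed_field) \<Rightarrow> real \<Rightarrow> bool" where
  "g_differentiable g a b f x \<longleftrightarrow> (\<exists>l. (g_quotient g f x \<longlongrightarrow> l) (g_filter g a b x))"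

definition g_deriv ::
    "(real \<Rightarrow> real) \<Rightarrow> real \<Rightarrow> real \<Rightarrow> (real \<Rightarrow> 'a::real_normed_field) \<Rightarrow> real \<Rightarrow> 'a" where
  "g_deriv g a b f x = Lim (g_filter g a b x) (g_quotient g f x)"

definition g_continuous_on ::
    "(real \<Rightarrow> real) \<Rightarrow> real set \<Rightarrow> (real \<Rightarrow> 'a::real_normed_field) \<Rightarrow> bool" where
  "g_continuous_on g S f \<longleftrightarrow>
     (\<forall>x\<in>S. \<forall>\<epsilon>>0. \<exists>\<delta>>0. \<forall>y\<in>S. \<bar>g y - g x\<bar> < \<delta> \<longrightarrow> norm (f y - f x) < \<epsilon>)"

primrec g_Ck ::
    "(real \<Rightarrow> real) \<Rightarrow> real \<Rightarrow> real \<Rightarrow> nat \<Rightarrow> (real \<Rightarrow> 'a::real_normed_field) set" where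
  "g_Ck g a b 0 = {f. g_continuous_on g {a..b} f}"
| "g_Ck g a b (Suc k) =
     {f. g_continuous_on g {a..b} f \<and> (\<forall>x\<in>{a..b}. g_differentiable g a b f x)
         \<and> g_deriv g a b f \<in> g_Ck g a b k}"

end

theory Submission
  imports Defs
begin

text \<open>
  Write \<open>h\<^sub>n = g\<^sub>n / n!\<close> and \<open>A\<^sub>n = a\<^sub>n n!\<close>, so that \<open>h\<^sub>n\<^sub>+\<^sub>1(x)\<close> is the integral of \<open>h\<^sub>n\<close> over \<open>[x\<^sub>0, x)\<close> and
  \<open>v = \<Sum> A\<^sub>n h\<^sub>n\<close>. Formal \<open>g\<close>-differentiation shifts the coefficients, \<open>V\<^sub>k = \<Sum> A\<^sub>n\<^sub>+\<^sub>k h\<^sub>n\<close>, and the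
  recurrence is the equation between the shifted series.

  Convergence is a Gronwall argument: \<open>T\<^sub>n = \<Sum>\<^bsub>k<m\<^esub> |A\<^sub>n\<^sub>+\<^sub>k|\<close> satisfies \<open>T\<^sub>n\<^sub>+\<^sub>1 \<le> M T\<^sub>n + |r\<^sub>n| n!\<close>, hence the
  partial sums of \<open>\<Sum> T\<^sub>n h\<^sub>n\<close> satisfy an integral inequality that bounds them uniformly. The
  derivative is justified by the estimate, for \<open>x < y\<close>,
  \<open>0 \<le> h\<^sub>n\<^sub>+\<^sub>1(y) - h\<^sub>n\<^sub>+\<^sub>1(x) - h\<^sub>n(x) (g(y) - g(x)) \<le> (h\<^sub>n(y) - h\<^sub>n(x)) (g(y) - g(x\<^sup>+))\<close>,
  whose last factor is the measure of the open interval \<open>(x, y)\<close> and therefore also controls the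
  limit at a jump of \<open>g\<close>. Summing it against \<open>A\<^sub>n\<^sub>+\<^sub>k\<^sub>+\<^sub>1\<close> gives the remainder of \<open>V\<^sub>k\<close> without integrating
  functions with values in the coefficient field, which is not assumed to be second countable.
\<close>

section \<open>Stieltjes integrals and divided monomials\<close>

definition right_lim :: "(real \<Rightarrow> real) \<Rightarrow> real \<Rightarrow> real" where
  "right_lim g x = Lim (at_right x) g"

definition g_pow :: "(real \<Rightarrow> real) \<Rightarrow> real \<Rightarrow> nat \<Rightarrow> real \<Rightarrow> real" where
  "g_pow g x0 n x = g_monomial g x0 n x / fact n"

lemma jump_right_lim: "jump g x = right_lim g x - g x"
  by (simp add: jump_def right_lim_def)

context
  fixes g :: "real \<Rightarrow> real"
  assumes g: "derivator g"
begin

lemma derivator_le: "x \<le> y \<Longrightarrow> g x \<le> g y"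
  using g by (auto simp: derivator_def monoD)

lemma derivator_left: "(g \<longlongrightarrow> g x) (at_left x)"
  using g by (simp add: derivator_def continuous_within)

text \<open>Monotonicity makes the right limit exist, as the infimum of the values to the right;
  only this ties the \<open>Lim\<close> in \<open>right_lim\<close> to an actual limit.\<close>

lemma derivator_right: "(g \<longlongrightarrow> right_lim g x) (at_right x)"
proof -
  have "(g \<longlongrightarrow> Inf (g ` ({x<..} \<inter> UNIV))) (at x within ({x<..} \<inter> UNIV))"
    by (rule Lim_right_bound[where K = "g x"]) (auto intro: derivator_le)
  then show ?thesis
    unfolding right_lim_def by (simp add: tendsto_Lim)
qed

lemma right_lim_ge: "g x \<le> right_lim g x"
  by (rule tendsto_lowerbound[OF derivator_right])
    (auto simp: eventually_at_filter intro!: always_eventually derivator_le)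

lemma right_lim_le:
  assumes "x < y"
  shows "right_lim g x \<le> g y"
proof (rule tendsto_upperbound[OF derivator_right])
  show "eventually (\<lambda>z. g z \<le> g y) (at_right x)"
    by (rule eventually_mono[OF eventually_at_right_real[OF assms]]) (auto intro: derivator_le)
qed auto

lemma right_lim_not_D: "x \<notin> D_set g \<Longrightarrow> right_lim g x = g x"
  using right_lim_ge[of x] by (auto simp: D_set_def jump_right_lim)

lemma derivator_tendsto:
  assumes "x \<notin> D_set g"
  shows "(g \<longlongrightarrow> g x) (at x within A)"
proof -
  have "(g \<longlongrightarrow> g x) (at x)"
    using derivator_left[of x] derivator_right[of x] right_lim_not_D[OF assms]
    by (simp add: filterlim_split_at)
  then show ?thesis
    by (rule tendsto_within_subset) auto
qed

lemma emeasure_stieltjes_le: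
  "a \<le> b \<Longrightarrow> emeasure (stieltjes g) {a..<b} = ennreal (g b - g a)"
  using emeasure_stieltjes[OF g, of a b] by (cases "a = b") auto

lemma measure_stieltjes: "a \<le> b \<Longrightarrow> measure (stieltjes g) {a..<b} = g b - g a"
  by (simp add: emeasure_stieltjes_le measure_def derivator_le)

text \<open>The open interval is the increasing union of the intervals \<open>{x + d n..<y}\<close>
  with \<open>d n\<close> decreasing to 0, so continuity of the measure from below replaces
  \<open>g (x + d n)\<close> by the right limit.\<close>

lemma measure_stieltjes_Ioo:
  assumes "x < y"
  shows "measure (stieltjes g) {x<..<y} = g y - right_lim g x"
    and "emeasure (stieltjes g) {x<..<y} < \<infinity>"
proof -
  show fin: "emeasure (stieltjes g) {x<..<y} < \<infinity>"
    by (rule le_less_trans[OF emeasure_mono[of _ "{x..<y}"]])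
      (use assms in \<open>auto simp: emeasure_stieltjes_le\<close>)
  define d where "d n = (y - x) / real (Suc n)" for n
  have d: "0 < d n" "d n \<le> y - x" "d (Suc n) \<le> d n" for n
    using assms unfolding d_def
    by (simp, simp add: divide_le_eq mult_le_cancel_left1, intro divide_left_mono, auto)
  have d0: "d \<longlonglongrightarrow> 0"
    unfolding d_def by (rule LIMSEQ_Suc[OF lim_const_over_n])
  have U: "(\<Union>n. {x + d n..<y}) = {x<..<y}"
  proof (intro equalityI subsetI)
    fix z assume z: "z \<in> {x<..<y}"
    have "eventually (\<lambda>n. d n < z - x) sequentially"
      using z by (intro order_tendstoD(2)[OF d0]) auto
    then obtain n where "d n < z - x"
      by (auto simp: eventually_sequentially)
    with z show "z \<in> (\<Union>n. {x + d n..<y})"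
      by (auto intro!: exI[of _ n])
  next
    fix z assume "z \<in> (\<Union>n. {x + d n..<y})"
    then show "z \<in> {x<..<y}"
      using d(1) by (auto intro: less_le_trans[of x "x + d _"])
  qed
  have "(\<lambda>n. measure (stieltjes g) {x + d n..<y}) \<longlonglongrightarrow> measure (stieltjes g) (\<Union>n. {x + d n..<y})"
  proof (rule Lim_measure_incseq)
    show "incseq (\<lambda>n. {x + d n..<y})"
      using d(3) by (intro incseq_SucI) (auto intro: order_trans[rotated])
    show "emeasure (stieltjes g) (\<Union>n. {x + d n..<y}) \<noteq> \<infinity>"
      using fin by (simp add: U)
  qed auto
  moreover have "measure (stieltjes g) {x + d n..<y} = g y - g (x + d n)" for n
    using d(2)[of n] by (intro measure_stieltjes) auto
  ultimately have "(\<lambda>n. g y - g (x + d n)) \<longlonglongrightarrow> measure (stieltjes g) {x<..<y}"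
    by (simp add: U)
  moreover have "filterlim (\<lambda>n. x + d n) (at_right x) sequentially"
    unfolding filterlim_at using d(1)
    by (auto intro!: always_eventually tendsto_eq_intros d0 simp: less_imp_neq[OF d(1), symmetric])
  then have "(\<lambda>n. g y - g (x + d n)) \<longlonglongrightarrow> g y - right_lim g x"
    by (intro tendsto_intros filterlim_compose[OF derivator_right])
  ultimately show "measure (stieltjes g) {x<..<y} = g y - right_lim g x"
    by (rule LIMSEQ_unique)
qed

section \<open>Integrals of functions that are monotone on the ray from \<open>x0\<close>\<close>

context
  fixes \<phi> :: "real \<Rightarrow> real" and x0 :: real
  assumes \<phi>: "mono_on {x0..} \<phi>"
begin

text \<open>A monotone function is Borel on the ray, and on \<open>{x..<y}\<close> it stays between
  \<open>\<phi> x\<close> and \<open>\<phi> y\<close> while the measure is finite.\<close>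

lemma mono_on_set_integrable:
  assumes "x0 \<le> x" "A \<in> sets borel" "A \<subseteq> {x..<y}"
  shows "set_integrable (stieltjes g) A \<phi>"
proof (cases "x \<le> y")
  case True
  have "\<phi> \<in> borel_measurable (restrict_space borel {x0..})"
    by (rule borel_measurable_mono_on_fnc[OF \<phi>])
  then have "\<phi> \<in> borel_measurable (restrict_space borel A)"
    by (rule measurable_restrict_mono) (use assms in auto)
  then have m: "(\<lambda>t. indicator A t *\<^sub>R \<phi> t) \<in> borel_measurable borel"
    using assms(2) by (subst (asm) borel_measurable_restrict_space_iff) (auto simp: mult.commute)
  have "emeasure (stieltjes g) A \<le> emeasure (stieltjes g) {x..<y}"
    using assms by (intro emeasure_mono) auto
  also have "\<dots> < \<infinity>"
    using True by (simp add: emeasure_stieltjes_le)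
  finally have fin: "emeasure (stieltjes g) A < \<infinity>" .
  show ?thesis
    unfolding set_integrable_def
  proof (rule integrableI_bounded_set[where A = A and B = "max \<bar>\<phi> x\<bar> \<bar>\<phi> y\<bar>"])
    show "AE t in stieltjes g. t \<in> A \<longrightarrow> norm (indicator A t *\<^sub>R \<phi> t) \<le> max \<bar>\<phi> x\<bar> \<bar>\<phi> y\<bar>"
    proof (intro AE_I2 impI)
      fix t assume "t \<in> A"
      with assms have "x \<le> t" "t \<le> y" by auto
      then have "\<phi> x \<le> \<phi> t" "\<phi> t \<le> \<phi> y"
        using assms(1) by (auto intro!: mono_onD[OF \<phi>])
      with \<open>t \<in> A\<close> show "norm (indicator A t *\<^sub>R \<phi> t) \<le> max \<bar>\<phi> x\<bar> \<bar>\<phi> y\<bar>"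
        by auto
    qed
  qed (use assms m fin in \<open>auto simp: measurable_def\<close>)
qed (use assms in \<open>auto simp: set_integrable_def\<close>)

text \<open>On \<open>{x..<y}\<close> the function exceeds \<open>\<phi> x\<close> by at most
  \<open>\<phi> y - \<phi> x\<close>, and by nothing at the point \<open>x\<close> itself. The
  excess is therefore charged to the open interval only, and an atom at \<open>x\<close> contributes
  just \<open>\<phi> x\<close> times its mass.\<close>

lemma LINT_mono_on_bounds:
  assumes "x0 \<le> x" "x < y"
  shows "\<phi> x * (g y - g x) \<le> (LINT t:{x..<y}|stieltjes g. \<phi> t)"
    and "(LINT t:{x..<y}|stieltjes g. \<phi> t)
           \<le> \<phi> x * (g y - g x) + (\<phi> y - \<phi> x) * (g y - right_lim g x)"
proof -
  have mon: "\<phi> x \<le> \<phi> t" "\<phi> t \<le> \<phi> y" if "t \<in> {x..<y}" for t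
    using assms that by (auto intro!: mono_onD[OF \<phi>])
  have fin: "emeasure (stieltjes g) {x..<y} < \<infinity>"
    using assms by (simp add: emeasure_stieltjes_le)
  have int: "set_integrable (stieltjes g) {x..<y} \<phi>"
    using assms by (intro mono_on_set_integrable) auto
  have ci: "set_integrable (stieltjes g) {x..<y} (\<lambda>_. k)" for k :: real
    using fin by (simp add: set_integrable_def integrable_mult_left)
  have ci': "set_integrable (stieltjes g) {x..<y} (\<lambda>t. indicator {x<..<y} t * k)" for k :: real
    using ci[of k] by (rule set_integrable_bound) (auto simp: set_borel_measurable_def split: split_indicator)
  have c: "(LINT t:{x..<y}|stieltjes g. k) = k * (g y - g x)" for k :: real
    using assms by (simp add: set_lebesgue_integral_def measure_stieltjes)
  have c': "(LINT t:{x..<y}|stieltjes g. indicator {x<..<y} t * k) = k * (g y - right_lim g x)" for k :: real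
  proof -
    have "(LINT t:{x..<y}|stieltjes g. indicator {x<..<y} t * k) = (LINT t:{x<..<y}|stieltjes g. k)"
      unfolding set_lebesgue_integral_def by (intro Bochner_Integration.integral_cong) (auto split: split_indicator)
    also have "\<dots> = k * (g y - right_lim g x)"
      using measure_stieltjes_Ioo[OF assms(2)] by (simp add: set_lebesgue_integral_def)
    finally show ?thesis .
  qed
  show "\<phi> x * (g y - g x) \<le> (LINT t:{x..<y}|stieltjes g. \<phi> t)"
    unfolding c[symmetric] by (intro set_integral_mono int ci mon)
  have "(LINT t:{x..<y}|stieltjes g. \<phi> t)
      \<le> (LINT t:{x..<y}|stieltjes g. \<phi> x + indicator {x<..<y} t * (\<phi> y - \<phi> x))"
  proof (intro set_integral_mono int set_integral_add ci ci')
    fix t assume t: "t \<in> {x..<y}"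
    show "\<phi> t \<le> \<phi> x + indicator {x<..<y} t * (\<phi> y - \<phi> x)"
      using mon[OF t] t by (cases "t = x") auto
  qed
  also have "\<dots> = \<phi> x * (g y - g x) + (\<phi> y - \<phi> x) * (g y - right_lim g x)"
    by (simp only: set_integral_add(2)[OF ci ci'] c c')
  finally show "(LINT t:{x..<y}|stieltjes g. \<phi> t)
      \<le> \<phi> x * (g y - g x) + (\<phi> y - \<phi> x) * (g y - right_lim g x)" .
qed

lemma LINT_split:
  assumes "x0 \<le> x" "x \<le> y"
  shows "(LINT t:{x0..<y}|stieltjes g. \<phi> t)
    = (LINT t:{x0..<x}|stieltjes g. \<phi> t) + (LINT t:{x..<y}|stieltjes g. \<phi> t)"
proof -
  have "{x0..<y} = {x0..<x} \<union> {x..<y}" using assms by auto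
  moreover have "{x0..<x} \<inter> {x..<y} = {}" by auto
  ultimately show ?thesis
    using assms
    by (simp add: set_integral_Un mono_on_set_integrable[of x0 _ x] mono_on_set_integrable[of x _ y])
qed

end

section \<open>Monotonicity and increments of the divided monomials\<close>

lemma g_pow_0 [simp]: "g_pow g x0 0 x = 1"
  by (simp add: g_pow_def)

lemma g_pow_Suc:
  assumes "x0 \<le> x"
  shows "g_pow g x0 (Suc n) x = (LINT t:{x0..<x}|stieltjes g. g_pow g x0 n t)"
  using assms unfolding g_pow_def by (simp add: field_simps del: of_nat_Suc)

lemma g_pow_Suc_self [simp]: "g_pow g x0 (Suc n) x0 = 0"
  by (simp add: g_pow_Suc set_lebesgue_integral_def)

text \<open>The two properties feed each other: a nonnegative monomial has an increasing successor,
  and since the successor vanishes at \<open>x0\<close> it is again nonnegative. Hence the joint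
  induction.\<close>

lemma g_pow_mono: "mono_on {x0..} (g_pow g x0 n) \<and> (\<forall>x\<ge>x0. 0 \<le> g_pow g x0 n x)"
proof (induction n)
  case 0
  then show ?case by (auto simp: mono_on_def)
next
  case (Suc n)
  then have mon: "mono_on {x0..} (g_pow g x0 n)" and pos: "\<And>x. x \<ge> x0 \<Longrightarrow> 0 \<le> g_pow g x0 n x"
    by auto
  have "g_pow g x0 (Suc n) x \<le> g_pow g x0 (Suc n) y" if "x0 \<le> x" "x < y" for x y
  proof -
    have "0 \<le> g_pow g x0 n x * (g y - g x)"
      using that pos derivator_le[of x y] by auto
    also have "\<dots> \<le> (LINT t:{x..<y}|stieltjes g. g_pow g x0 n t)"
      by (rule LINT_mono_on_bounds(1)[OF mon that])
    finally show ?thesis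
      using that LINT_split[OF mon, of x y] by (simp add: g_pow_Suc)
  qed
  then have "mono_on {x0..} (g_pow g x0 (Suc n))"
    by (auto simp: mono_on_def le_less)
  moreover from this have "0 \<le> g_pow g x0 (Suc n) x" if "x \<ge> x0" for x
    using that mono_onD[of "{x0..}" "g_pow g x0 (Suc n)" x0 x] by auto
  ultimately show ?case by auto
qed

lemma g_pow_le: "x0 \<le> x \<Longrightarrow> x \<le> y \<Longrightarrow> g_pow g x0 n x \<le> g_pow g x0 n y"
  using g_pow_mono by (auto simp: mono_on_def)

lemma g_pow_nonneg: "x0 \<le> x \<Longrightarrow> 0 \<le> g_pow g x0 n x"
  using g_pow_mono by auto

text \<open>The increment of the next monomial is the integral of \<open>g_pow g x0 n\<close> over
  \<open>{x..<y}\<close>, to which the bounds for monotone integrands apply.\<close>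

lemma g_pow_diff_bounds:
  assumes "x0 \<le> x" "x < y"
  shows "g_pow g x0 n x * (g y - g x) \<le> g_pow g x0 (Suc n) y - g_pow g x0 (Suc n) x"
    and "g_pow g x0 (Suc n) y - g_pow g x0 (Suc n) x
      \<le> g_pow g x0 n x * (g y - g x) + (g_pow g x0 n y - g_pow g x0 n x) * (g y - right_lim g x)"
  using LINT_mono_on_bounds[OF conjunct1[OF g_pow_mono] assms, of n]
    LINT_split[OF conjunct1[OF g_pow_mono], of x0 x y n] assms
  by (simp_all add: g_pow_Suc)

text \<open>Enlarging the mass of the open interval to \<open>g y - g x\<close> merges the two terms
  of the upper bound into one, evaluated at the right endpoint.\<close>

lemma g_pow_diff_le:
  assumes "x0 \<le> x" "x \<le> y"
  shows "g_pow g x0 (Suc n) y - g_pow g x0 (Suc n) x \<le> g_pow g x0 n y * (g y - g x)"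
proof (cases "x = y")
  case False
  then have xy: "x < y" using assms by auto
  have "(g_pow g x0 n y - g_pow g x0 n x) * (g y - right_lim g x)
      \<le> (g_pow g x0 n y - g_pow g x0 n x) * (g y - g x)"
    using assms by (intro mult_left_mono) (auto simp: g_pow_le right_lim_ge)
  with g_pow_diff_bounds(2)[OF assms(1) xy, of n] show ?thesis
    by (simp add: algebra_simps)
qed auto

end

section \<open>Power series in the monomials\<close>

context
  fixes g :: "real \<Rightarrow> real" and x0 c :: real
  assumes g: "derivator g"
begin

text \<open>The partial sums \<open>E N\<close> obey an integral inequality whose constants
  \<open>M\<close> and \<open>R\<close> do not depend on \<open>N\<close>. If the open interval
  between \<open>x\<close> and \<open>y\<close> has mass at most \<open>1 / (2 * M)\<close>, the
  unknown \<open>E N y\<close> is absorbed and boundedness passes from \<open>x\<close> to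
  \<open>y\<close>; bisection then carries it from \<open>x0\<close> to \<open>c\<close>. Bounded
  partial sums of nonnegative terms converge.\<close>

lemma g_pow_gronwall:
  fixes T \<rho> :: "nat \<Rightarrow> real"
  assumes "x0 \<le> c" and M: "M > 0"
    and T0: "\<And>n. 0 \<le> T n" and \<rho>0: "\<And>n. 0 \<le> \<rho> n"
    and rec: "\<And>n. T (Suc n) \<le> M * T n + \<rho> n"
    and sum: "summable (\<lambda>n. \<rho> n * g_pow g x0 n c)"
  shows "summable (\<lambda>n. T n * g_pow g x0 n c)"
proof -
  define E where "E N x = (\<Sum>n<N. T n * g_pow g x0 n x)" for N x
  define R where "R = (\<Sum>n. \<rho> n * g_pow g x0 n c)"
  note nonneg = g_pow_nonneg[OF g] and le = g_pow_le[OF g]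
  \<comment> \<open>The whole mass, including a jump at \<open>x\<close>, multiplies the known value
    \<open>E N x\<close>; the unknown \<open>E N y\<close> meets only the mass of the open interval.
    A large jump therefore does no harm.\<close>
  have step: "E N y - E N x
      \<le> (M * E N x + R) * (g y - g x) + (M * E N y + R) * (g y - right_lim g x)"
    if xy: "x0 \<le> x" "x < y" "y \<le> c" for N x y
  proof -
    define u where "u n = M * T n + \<rho> n" for n
    have u0: "0 \<le> u n" for n
      using M T0 \<rho>0 by (simp add: u_def)
    have gg: "0 \<le> g y - g x" "0 \<le> g y - right_lim g x"
      using xy derivator_le[OF g, of x y] right_lim_le[OF g, of x y] by auto
    \<comment> \<open>This is the upper bound for the increment of the next monomial, weakened by
      dropping a negative term so that both summands are nonnegative.\<close>
    define b where "b n = g_pow g x0 n x * (g y - g x) + g_pow g x0 n y * (g y - right_lim g x)" for n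
    have b0: "0 \<le> b n" for n
      using gg xy by (auto simp: b_def intro!: add_nonneg_nonneg mult_nonneg_nonneg nonneg)
    have ub: "(\<Sum>n<N. u n * g_pow g x0 n z) \<le> M * E N z + R" if z: "x0 \<le> z" "z \<le> c" for z
    proof -
      have "(\<Sum>n<N. \<rho> n * g_pow g x0 n z) \<le> (\<Sum>n<N. \<rho> n * g_pow g x0 n c)"
        using z by (intro sum_mono mult_left_mono \<rho>0 le)
      also have "\<dots> \<le> R"
        unfolding R_def using assms(1) by (intro sum_le_suminf sum) (auto simp: \<rho>0 nonneg)
      finally show ?thesis
        by (simp add: E_def u_def distrib_right sum.distrib sum_distrib_left mult.assoc)
    qed
    have "E N y - E N x = (\<Sum>n<N. T n * (g_pow g x0 n y - g_pow g x0 n x))"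
      by (simp add: E_def sum_subtractf right_diff_distrib)
    also have "\<dots> \<le> (\<Sum>n<N. u n * b n)"
    proof (cases N)
      case (Suc N')
      \<comment> \<open>The monomial of index 0 is constant, so only shifted terms remain, and
        \<open>rec\<close> replaces \<open>T (Suc n)\<close> by \<open>u n\<close>.\<close>
      have "(\<Sum>n<N. T n * (g_pow g x0 n y - g_pow g x0 n x))
          = (\<Sum>n<N'. T (Suc n) * (g_pow g x0 (Suc n) y - g_pow g x0 (Suc n) x))"
        unfolding Suc sum.lessThan_Suc_shift by (simp add: g)
      also have "\<dots> \<le> (\<Sum>n<N'. u n * b n)"
      proof (intro sum_mono mult_mono)
        fix n
        show "T (Suc n) \<le> u n" by (simp add: u_def rec)
        have "(g_pow g x0 n y - g_pow g x0 n x) * (g y - right_lim g x)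
            \<le> g_pow g x0 n y * (g y - right_lim g x)"
          using gg xy by (intro mult_right_mono) (auto simp: nonneg)
        then show "g_pow g x0 (Suc n) y - g_pow g x0 (Suc n) x \<le> b n"
          using g_pow_diff_bounds(2)[OF g xy(1,2), of n] by (simp add: b_def)
      qed (use xy u0 in \<open>auto intro: le\<close>)
      also have "\<dots> \<le> (\<Sum>n<N. u n * b n)"
        unfolding Suc by (simp add: u0 b0)
      finally show ?thesis .
    qed auto
    also have "\<dots> = (\<Sum>n<N. u n * g_pow g x0 n x) * (g y - g x)
        + (\<Sum>n<N. u n * g_pow g x0 n y) * (g y - right_lim g x)"
      by (simp add: b_def distrib_left sum.distrib sum_distrib_right mult.assoc)
    also have "\<dots> \<le> (M * E N x + R) * (g y - g x) + (M * E N y + R) * (g y - right_lim g x)"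
      using xy by (intro add_mono mult_right_mono ub gg) auto
    finally show ?thesis .
  qed
  \<comment> \<open>The bound may depend on \<open>x\<close> but not on \<open>N\<close>; this is
    the property propagated from \<open>x0\<close> to \<open>c\<close>.\<close>
  define bnd where "bnd x \<longleftrightarrow> (\<exists>B. \<forall>N. E N x \<le> B)" for x
  have E0: "0 \<le> E N x" if "x0 \<le> x" for N x
    unfolding E_def using that by (intro sum_nonneg mult_nonneg_nonneg T0 nonneg)
  have R0: "0 \<le> R"
    unfolding R_def using assms(1) by (intro suminf_nonneg sum mult_nonneg_nonneg \<rho>0 nonneg)
  have bnd_step: "bnd y"
    if xy: "x0 \<le> x" "x < y" "y \<le> c" and small: "g y - right_lim g x \<le> 1 / (2 * M)" and bx: "bnd x"
    for x y
  proof -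
    from bx obtain B where B: "\<And>N. E N x \<le> B" by (auto simp: bnd_def)
    \<comment> \<open>Since \<open>(M * E N y + R) / (2 * M)\<close> equals
      \<open>E N y / 2 + R / (2 * M)\<close>, half of \<open>E N y\<close> moves to the left; hence
      the factor 2.\<close>
    have "E N y \<le> 2 * (B + (M * B + R) * (g y - g x) + R / (2 * M))" for N
    proof -
      have "E N y \<le> E N x + (M * E N x + R) * (g y - g x) + (M * E N y + R) * (g y - right_lim g x)"
        using step[OF xy, of N] by simp
      also have "\<dots> \<le> B + (M * B + R) * (g y - g x) + (M * E N y + R) * (1 / (2 * M))"
        using B[of N] M small E0[of y N] R0 xy derivator_le[OF g, of x y]
        by (intro add_mono mult_right_mono mult_left_mono) auto
      also have "(M * E N y + R) * (1 / (2 * M)) = E N y / 2 + R / (2 * M)"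
        using M by (simp add: field_simps)
      finally show ?thesis by simp
    qed
    then show ?thesis by (auto simp: bnd_def)
  qed
  \<comment> \<open>The form is dictated by the bisection principle \<open>Bolzano\<close>, applied
    to the property that boundedness passes from the left end of a subinterval to its right
    end.\<close>
  have "x0 \<le> x0 \<and> c \<le> c \<and> bnd x0 \<longrightarrow> bnd c"
    using assms(1)
  proof (induction rule: Bolzano[where P = "\<lambda>x y. x0 \<le> x \<and> y \<le> c \<and> bnd x \<longrightarrow> bnd y"])
    case (trans a b d)
    then show ?case by auto
  next
    case (local x)
    have M': "1 / (2 * M) > 0" using M by simp
    \<comment> \<open>Left continuity makes the mass of \<open>{a..<x}\<close> small for
      \<open>a\<close> near \<open>x\<close>, and the right limit does the same for
      \<open>{x<..<b}\<close>. A jump at \<open>x\<close> is crossed by stopping there: first from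
      \<open>a\<close> to \<open>x\<close>, then from \<open>x\<close> to \<open>b\<close>.\<close>
    have "eventually (\<lambda>y. g x - 1 / (2 * M) < g y) (at_left x)"
      using M' by (intro order_tendstoD(1)[OF derivator_left[OF g]]) auto
    then obtain l where l: "l < x" "\<And>y. l < y \<Longrightarrow> y < x \<Longrightarrow> g x - 1 / (2 * M) < g y"
      by (auto simp: eventually_at_left_field)
    have "eventually (\<lambda>y. g y < right_lim g x + 1 / (2 * M)) (at_right x)"
      using M' by (intro order_tendstoD(2)[OF derivator_right[OF g]]) auto
    then obtain r where r: "x < r" "\<And>y. x < y \<Longrightarrow> y < r \<Longrightarrow> g y < right_lim g x + 1 / (2 * M)"
      by (auto simp: eventually_at_right_field)
    show ?case
    proof (intro exI[of _ "min (x - l) (r - x)"] conjI allI impI)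
      show "0 < min (x - l) (r - x)" using l r by auto
    next
      fix a b assume ab: "a \<le> x \<and> x \<le> b \<and> b - a < min (x - l) (r - x)"
        and h: "x0 \<le> a \<and> b \<le> c \<and> bnd a"
      have "bnd x"
      proof (cases "a = x")
        case False
        then have "g x - g a < 1 / (2 * M)"
          using l(2)[of a] ab by auto
        then show ?thesis
          using False ab h right_lim_ge[OF g, of a] by (intro bnd_step[of a x]) auto
      qed (use h in auto)
      show "bnd b"
      proof (cases "b = x")
        case False
        then have "g b - right_lim g x < 1 / (2 * M)"
          using r(2)[of b] ab by auto
        then show ?thesis
          using False ab h \<open>bnd x\<close> by (intro bnd_step[of x b]) auto
      qed (use \<open>bnd x\<close> in auto)
    qed
  qed
  moreover have "bnd x0"
  proof -
    \<comment> \<open>All monomials of positive index vanish at \<open>x0\<close>; for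
      \<open>N = 0\<close> the sum is empty.\<close>
    have "E N x0 \<le> T 0" for N
      by (cases N) (auto simp: E_def T0 sum.lessThan_Suc_shift g simp del: sum.lessThan_Suc)
    then show ?thesis by (auto simp: bnd_def)
  qed
  ultimately obtain B where B: "\<And>N. E N c \<le> B"
    by (auto simp: bnd_def)
  show ?thesis
    by (rule bounded_imp_summable[where B = B])
      (use assms(1) B[of "Suc _"] in \<open>auto simp: T0 nonneg E_def lessThan_Suc_atMost\<close>)
qed

section \<open>Majorants, \<open>g\<close>-continuity and remainders of the series\<close>

lemma summable_g_pow_le:
  fixes A :: "nat \<Rightarrow> 'a::{real_normed_field, banach}"
  assumes "summable (\<lambda>n. norm (A n) * g_pow g x0 n c)" "x0 \<le> x" "x \<le> c"
  shows "summable (\<lambda>n. norm (A n) * g_pow g x0 n x)"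
    and "summable (\<lambda>n. A n * of_real (g_pow g x0 n x))"
proof -
  show *: "summable (\<lambda>n. norm (A n) * g_pow g x0 n x)"
    using assms
    by (intro summable_comparison_test'[OF assms(1), of 0])
      (auto simp: abs_mult g g_pow_nonneg intro!: mult_left_mono g_pow_le)
  have "summable (\<lambda>n. norm (A n * of_real (g_pow g x0 n x)))"
    using * assms(2) by (simp add: norm_mult g g_pow_nonneg)
  then show "summable (\<lambda>n. A n * of_real (g_pow g x0 n x))"
    by (rule summable_norm_cancel)
qed

text \<open>The monomials increase, so taking norms termwise makes the real series with coefficients
  \<open>norm (A n)\<close> a majorant of all increments.\<close>

lemma g_pow_series_diff_le:
  fixes A :: "nat \<Rightarrow> 'a::{real_normed_field, banach}"
  assumes "summable (\<lambda>n. norm (A n) * g_pow g x0 n c)" "x0 \<le> x" "x \<le> y" "y \<le> c"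
  shows "norm ((\<Sum>n. A n * of_real (g_pow g x0 n y)) - (\<Sum>n. A n * of_real (g_pow g x0 n x)))
    \<le> (\<Sum>n. norm (A n) * g_pow g x0 n y) - (\<Sum>n. norm (A n) * g_pow g x0 n x)"
proof -
  note s = summable_g_pow_le[OF assms(1)]
  have "(\<Sum>n. A n * of_real (g_pow g x0 n y)) - (\<Sum>n. A n * of_real (g_pow g x0 n x))
      = (\<Sum>n. A n * of_real (g_pow g x0 n y) - A n * of_real (g_pow g x0 n x))"
    using assms by (intro suminf_diff s) auto
  also have "norm \<dots> \<le> (\<Sum>n. norm (A n) * g_pow g x0 n y - norm (A n) * g_pow g x0 n x)"
  proof (rule norm_suminf_le)
    show "norm (A n * of_real (g_pow g x0 n y) - A n * of_real (g_pow g x0 n x))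
        \<le> norm (A n) * g_pow g x0 n y - norm (A n) * g_pow g x0 n x" for n
      using g_pow_le[OF g assms(2,3), of n]
      by (simp add: norm_mult flip: right_diff_distrib of_real_diff)
  qed (use assms in \<open>auto intro!: summable_diff s\<close>)
  also have "\<dots> = (\<Sum>n. norm (A n) * g_pow g x0 n y) - (\<Sum>n. norm (A n) * g_pow g x0 n x)"
    using assms by (intro suminf_diff[symmetric] s) auto
  finally show ?thesis .
qed

text \<open>The tail is uniformly small by its value at \<open>c\<close>, and each of the finitely
  many remaining terms is Lipschitz with respect to \<open>g\<close>. Hence one
  \<open>\<delta>\<close> serves all pairs of points.\<close>

lemma g_pow_series_increment_small:
  assumes w0: "\<And>n. 0 \<le> w n" and sum: "summable (\<lambda>n. w n * g_pow g x0 n c)" and "x0 \<le> c" "\<epsilon> > 0"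
  obtains \<delta> where "\<delta> > 0"
    "\<And>x y. x0 \<le> x \<Longrightarrow> x \<le> y \<Longrightarrow> y \<le> c \<Longrightarrow> g y - g x < \<delta> \<Longrightarrow>
       (\<Sum>n. w n * g_pow g x0 n y) - (\<Sum>n. w n * g_pow g x0 n x) < \<epsilon>"
proof -
  have "(\<lambda>N. \<Sum>n. w (n + N) * g_pow g x0 (n + N) c) \<longlonglongrightarrow> 0"
    by (rule suminf_exist_split2[OF sum])
  then have "eventually (\<lambda>N. (\<Sum>n. w (n + N) * g_pow g x0 (n + N) c) < \<epsilon> / 2) sequentially"
    using assms(4) by (intro order_tendstoD(2)) auto
  then obtain N where N: "(\<Sum>n. w (n + N) * g_pow g x0 (n + N) c) < \<epsilon> / 2"
    by (auto simp: eventually_sequentially)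
  \<comment> \<open>A Lipschitz constant, relative to \<open>g\<close>, for the first
    \<open>N\<close> terms. At \<open>n = 0\<close> the truncated \<open>n - 1\<close> is 0, and the
    bound is valid because that monomial is constant.\<close>
  define L where "L = (\<Sum>n<N. w n * g_pow g x0 (n - 1) c)"
  have L0: "0 \<le> L"
    unfolding L_def using assms(3) by (intro sum_nonneg mult_nonneg_nonneg w0 g_pow_nonneg g)
  show thesis
  \<comment> \<open>\<open>L + 1\<close> in place of \<open>L\<close> avoids a zero denominator; the
    head of the series takes the other \<open>\<epsilon> / 2\<close>.\<close>
  proof (rule that[of "\<epsilon> / (2 * (L + 1))"])
    show "\<epsilon> / (2 * (L + 1)) > 0" using L0 assms by simp
    fix x y assume xy: "x0 \<le> x" "x \<le> y" "y \<le> c" "g y - g x < \<epsilon> / (2 * (L + 1))"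
    have gxy: "0 \<le> g y - g x" using derivator_le[OF g xy(2)] by simp
    have s: "summable (\<lambda>n. w n * g_pow g x0 n z)" if "x0 \<le> z" "z \<le> c" for z
      using summable_g_pow_le(1)[of w z] that sum w0 by simp
    define d where "d n = w n * (g_pow g x0 n y - g_pow g x0 n x)" for n
    have sd: "summable d"
      using summable_diff[OF s[of y] s[of x]] xy by (simp add: d_def[abs_def] right_diff_distrib)
    have "(\<Sum>n. w n * g_pow g x0 n y) - (\<Sum>n. w n * g_pow g x0 n x) = suminf d"
      using xy by (subst suminf_diff) (auto intro: s simp: d_def[abs_def] right_diff_distrib)
    also have "\<dots> = (\<Sum>n. d (n + N)) + (\<Sum>n<N. d n)"
      by (rule suminf_split_initial_segment[OF sd])
    also have "(\<Sum>n. d (n + N)) \<le> (\<Sum>n. w (n + N) * g_pow g x0 (n + N) c)"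
    proof (rule suminf_le)
      fix n
      have "g_pow g x0 (n + N) y - g_pow g x0 (n + N) x \<le> g_pow g x0 (n + N) c"
        using xy g_pow_le[OF g, of x0 y c "n + N"] g_pow_nonneg[OF g, of x0 x "n + N"] by simp
      then show "d (n + N) \<le> w (n + N) * g_pow g x0 (n + N) c"
        by (simp add: d_def w0 mult_left_mono)
    qed (use summable_ignore_initial_segment[OF sd] summable_ignore_initial_segment[OF sum] in auto)
    also have "(\<Sum>n<N. d n) \<le> (\<Sum>n<N. w n * (g_pow g x0 (n - 1) c * (g y - g x)))"
    proof (rule sum_mono)
      fix n
      have "g_pow g x0 n y - g_pow g x0 n x \<le> g_pow g x0 (n - 1) c * (g y - g x)"
      proof (cases n)
        case (Suc k)
        have "g_pow g x0 (Suc k) y - g_pow g x0 (Suc k) x \<le> g_pow g x0 k y * (g y - g x)"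
          by (rule g_pow_diff_le[OF g xy(1,2)])
        also have "\<dots> \<le> g_pow g x0 k c * (g y - g x)"
          using xy gxy by (intro mult_right_mono g_pow_le g) auto
        finally show ?thesis using Suc by simp
      qed (use gxy g in simp)
      then show "d n \<le> w n * (g_pow g x0 (n - 1) c * (g y - g x))"
        unfolding d_def by (intro mult_left_mono w0)
    qed
    also have "(\<Sum>n<N. w n * (g_pow g x0 (n - 1) c * (g y - g x))) = L * (g y - g x)"
      by (simp add: L_def sum_distrib_right mult.assoc)
    also have "\<dots> \<le> (L + 1) * (g y - g x)"
      using gxy by (intro mult_right_mono) auto
    also have "\<dots> \<le> \<epsilon> / 2"
      using xy(4) L0 by (simp add: field_simps)
    finally show "(\<Sum>n. w n * g_pow g x0 n y) - (\<Sum>n. w n * g_pow g x0 n x) < \<epsilon>"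
      using N by simp
  qed
qed

lemma g_pow_series_g_continuous:
  fixes A :: "nat \<Rightarrow> 'a::{real_normed_field, banach}"
  assumes sum: "summable (\<lambda>n. norm (A n) * g_pow g x0 n c)"
  shows "g_continuous_on g {x0..c} (\<lambda>x. \<Sum>n. A n * of_real (g_pow g x0 n x))"
  unfolding g_continuous_on_def
proof (intro ballI allI impI)
  fix x \<epsilon> :: real assume x: "x \<in> {x0..c}" and "\<epsilon> > 0"
  then obtain \<delta> where \<delta>: "\<delta> > 0"
    "\<And>x y. x0 \<le> x \<Longrightarrow> x \<le> y \<Longrightarrow> y \<le> c \<Longrightarrow> g y - g x < \<delta> \<Longrightarrow>
       (\<Sum>n. norm (A n) * g_pow g x0 n y) - (\<Sum>n. norm (A n) * g_pow g x0 n x) < \<epsilon>"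
    using g_pow_series_increment_small[of "\<lambda>n. norm (A n)" \<epsilon>] sum by auto
  have *: "norm ((\<Sum>n. A n * of_real (g_pow g x0 n y)) - (\<Sum>n. A n * of_real (g_pow g x0 n x))) < \<epsilon>"
    if "x0 \<le> x" "x \<le> y" "y \<le> c" "\<bar>g y - g x\<bar> < \<delta>" for x y
  proof -
    have "g y - g x < \<delta>" using that(4) by linarith
    then show ?thesis
      using g_pow_series_diff_le[OF sum that(1-3)] \<delta>(2)[OF that(1-3)] by linarith
  qed
  show "\<exists>\<delta>>0. \<forall>y\<in>{x0..c}. \<bar>g y - g x\<bar> < \<delta> \<longrightarrow>
      norm ((\<Sum>n. A n * of_real (g_pow g x0 n y)) - (\<Sum>n. A n * of_real (g_pow g x0 n x))) < \<epsilon>"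
  proof (intro exI[of _ \<delta>] conjI ballI impI \<delta>(1))
    fix y assume y: "y \<in> {x0..c}" "\<bar>g y - g x\<bar> < \<delta>"
    show "norm ((\<Sum>n. A n * of_real (g_pow g x0 n y)) - (\<Sum>n. A n * of_real (g_pow g x0 n x))) < \<epsilon>"
    proof (cases "x \<le> y")
      case False
      then show ?thesis
        using *[of y x] x y by (simp add: norm_minus_commute abs_minus_commute)
    qed (use *[of x y] x y in simp)
  qed
qed

text \<open>The monomial estimates are summed against \<open>norm (A (Suc n))\<close>. Expansion at
  the left endpoint serves right limits, including those at jumps; expansion at the right endpoint
  serves left limits.\<close>

lemma g_pow_series_remainder:
  fixes A :: "nat \<Rightarrow> 'a::{real_normed_field, banach}"
  assumes sum: "summable (\<lambda>n. norm (A n) * g_pow g x0 n c)"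
    and sum': "summable (\<lambda>n. norm (A (Suc n)) * g_pow g x0 n c)"
    and xy: "x0 \<le> x" "x < y" "y \<le> c"
  defines "V \<equiv> \<lambda>x. \<Sum>n. A n * of_real (g_pow g x0 n x)"
    and "V' \<equiv> \<lambda>x. \<Sum>n. A (Suc n) * of_real (g_pow g x0 n x)"
    and "W \<equiv> \<lambda>x. \<Sum>n. norm (A (Suc n)) * g_pow g x0 n x"
  shows "norm (V y - V x - V' x * of_real (g y - g x)) \<le> (W y - W x) * (g y - right_lim g x)"
    and "norm (V y - V x - V' y * of_real (g y - g x)) \<le> (W y - W x) * (g y - g x)"
proof -
  note s = summable_g_pow_le[OF sum] and s' = summable_g_pow_le[OF sum']
  \<comment> \<open>Common part of both estimates: \<open>z\<close> is the point of expansion and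
    \<open>K\<close> the mass factor.\<close>
  have *: "norm (V y - V x - V' z * of_real (g y - g x)) \<le> (W y - W x) * K"
    if z: "x0 \<le> z" "z \<le> c"
      and K: "\<And>n. \<bar>g_pow g x0 (Suc n) y - g_pow g x0 (Suc n) x - g_pow g x0 n z * (g y - g x)\<bar>
               \<le> (g_pow g x0 n y - g_pow g x0 n x) * K"
    for z K
  proof -
    have "(\<lambda>n. A n * of_real (g_pow g x0 n y - g_pow g x0 n x)) sums (V y - V x)"
      unfolding V_def of_real_diff right_diff_distrib
      using xy by (intro sums_diff summable_sums s) auto
    \<comment> \<open>Dropping the term of index 0, whose increment is zero, aligns this series with
      the shifted coefficients of \<open>V'\<close>.\<close>
    then have "(\<lambda>n. A (Suc n) * of_real (g_pow g x0 (Suc n) y - g_pow g x0 (Suc n) x)) sums (V y - V x)"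
      by (subst sums_Suc_iff) (simp add: g)
    moreover have "(\<lambda>n. A (Suc n) * of_real (g_pow g x0 n z) * of_real (g y - g x))
        sums (V' z * of_real (g y - g x))"
      unfolding V'_def using z by (intro sums_mult2 summable_sums s') auto
    ultimately have 1: "(\<lambda>n. A (Suc n) * of_real (g_pow g x0 (Suc n) y - g_pow g x0 (Suc n) x)
        - A (Suc n) * of_real (g_pow g x0 n z) * of_real (g y - g x))
        sums (V y - V x - V' z * of_real (g y - g x))"
      by (rule sums_diff)
    have 2: "(\<lambda>n. (norm (A (Suc n)) * g_pow g x0 n y - norm (A (Suc n)) * g_pow g x0 n x) * K)
        sums ((W y - W x) * K)"
      unfolding W_def using xy by (intro sums_mult2 sums_diff summable_sums s') auto
    show ?thesis
      unfolding sums_unique[OF 1] sums_unique[OF 2]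
    proof (rule norm_suminf_le)
      show "summable (\<lambda>n. (norm (A (Suc n)) * g_pow g x0 n y - norm (A (Suc n)) * g_pow g x0 n x) * K)"
        using 2 by (rule sums_summable)
      fix n
      have "norm (A (Suc n) * of_real (g_pow g x0 (Suc n) y - g_pow g x0 (Suc n) x)
          - A (Suc n) * of_real (g_pow g x0 n z) * of_real (g y - g x))
        = norm (A (Suc n) * of_real (g_pow g x0 (Suc n) y - g_pow g x0 (Suc n) x - g_pow g x0 n z * (g y - g x)))"
        by (simp add: algebra_simps)
      also have "\<dots> \<le> norm (A (Suc n)) * ((g_pow g x0 n y - g_pow g x0 n x) * K)"
        unfolding norm_mult norm_of_real by (intro mult_left_mono K) auto
      finally show "norm (A (Suc n) * of_real (g_pow g x0 (Suc n) y - g_pow g x0 (Suc n) x)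
          - A (Suc n) * of_real (g_pow g x0 n z) * of_real (g y - g x))
          \<le> (norm (A (Suc n)) * g_pow g x0 n y - norm (A (Suc n)) * g_pow g x0 n x) * K"
        by (simp add: algebra_simps)
    qed
  qed
  note b = g_pow_diff_bounds[OF g xy(1,2)]
  show "norm (V y - V x - V' x * of_real (g y - g x)) \<le> (W y - W x) * (g y - right_lim g x)"
  proof (rule *)
    show "\<bar>g_pow g x0 (Suc n) y - g_pow g x0 (Suc n) x - g_pow g x0 n x * (g y - g x)\<bar>
        \<le> (g_pow g x0 n y - g_pow g x0 n x) * (g y - right_lim g x)" for n
      using b[of n] by simp
  qed (use xy in auto)
  show "norm (V y - V x - V' y * of_real (g y - g x)) \<le> (W y - W x) * (g y - g x)"
  proof (rule *)
    show "\<bar>g_pow g x0 (Suc n) y - g_pow g x0 (Suc n) x - g_pow g x0 n y * (g y - g x)\<bar>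
        \<le> (g_pow g x0 n y - g_pow g x0 n x) * (g y - g x)" for n
      using b(1)[of n] g_pow_diff_le[OF g, of x0 x y n] xy by (simp add: left_diff_distrib)
  qed (use xy in auto)
qed

end

section \<open>The Stieltjes derivative\<close>

text \<open>Brings the extended real endpoints in \<open>N_plus\<close> down to order statements
  about reals, so that components can be handled by real topology; the dual below does so for
  \<open>N_minus\<close>.\<close>

lemma Sup_ereal_image_iff:
  assumes "K \<noteq> {}"
  shows "Sup (ereal ` K) = ereal b \<longleftrightarrow> (\<forall>k\<in>K. k \<le> b) \<and> (\<forall>z<b. \<exists>k\<in>K. z < k)"
proof (intro iffI conjI ballI allI impI)
  fix k assume *: "Sup (ereal ` K) = ereal b" and k: "k \<in> K"
  have "ereal k \<le> Sup (ereal ` K)"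
    using k by (intro SUP_upper)
  then show "k \<le> b" by (simp add: *)
next
  fix z assume *: "Sup (ereal ` K) = ereal b" and z: "z < b"
  have "ereal z < Sup (ereal ` K)" using z by (simp add: *)
  then show "\<exists>k\<in>K. z < k" by (auto simp: less_Sup_iff)
next
  assume *: "(\<forall>k\<in>K. k \<le> b) \<and> (\<forall>z<b. \<exists>k\<in>K. z < k)"
  show "Sup (ereal ` K) = ereal b"
  proof (rule antisym)
    show "Sup (ereal ` K) \<le> ereal b"
      using * by (auto intro: SUP_least)
    show "ereal b \<le> Sup (ereal ` K)"
    proof (rule ccontr)
      assume "\<not> ereal b \<le> Sup (ereal ` K)"
      then obtain z where z: "Sup (ereal ` K) < ereal z" "ereal z < ereal b"
        using ereal_dense2 by (metis not_le)
      with * obtain k where k: "k \<in> K" "z < k" by auto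
      then have "ereal k \<le> Sup (ereal ` K)"
        by (intro SUP_upper)
      also note z(1)
      finally show False using k by simp
    qed
  qed
qed

lemma Inf_ereal_image_iff:
  assumes "K \<noteq> {}"
  shows "Inf (ereal ` K) = ereal b \<longleftrightarrow> (\<forall>k\<in>K. b \<le> k) \<and> (\<forall>z>b. \<exists>k\<in>K. k < z)"
proof (intro iffI conjI ballI allI impI)
  fix k assume *: "Inf (ereal ` K) = ereal b" and k: "k \<in> K"
  have "Inf (ereal ` K) \<le> ereal k"
    using k by (intro INF_lower)
  then show "b \<le> k" by (simp add: *)
next
  fix z assume *: "Inf (ereal ` K) = ereal b" and z: "b < z"
  have "Inf (ereal ` K) < ereal z" using z by (simp add: *)
  then show "\<exists>k\<in>K. k < z" by (auto simp: Inf_less_iff)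
next
  assume *: "(\<forall>k\<in>K. b \<le> k) \<and> (\<forall>z>b. \<exists>k\<in>K. k < z)"
  show "Inf (ereal ` K) = ereal b"
  proof (rule antisym)
    show "ereal b \<le> Inf (ereal ` K)"
      using * by (auto intro: INF_greatest)
    show "Inf (ereal ` K) \<le> ereal b"
    proof (rule ccontr)
      assume "\<not> Inf (ereal ` K) \<le> ereal b"
      then obtain z where z: "ereal z < Inf (ereal ` K)" "ereal b < ereal z"
        using ereal_dense2 by (metis not_le)
      with * obtain k where k: "k \<in> K" "k < z" by auto
      note z(1)
      also have "Inf (ereal ` K) \<le> ereal k"
        using k by (intro INF_lower)
      finally show False using k by simp
    qed
  qed
qed

text \<open>\<open>g_deriv\<close> is a \<open>Lim\<close>, so a limit determines it only along a
  proper filter; this and its mirror image supply properness.\<close>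

lemma at_within_right_nontrivial:
  fixes b :: real
  shows "x0 \<le> b \<Longrightarrow> b < c \<Longrightarrow> at b within {x0..c} \<inter> {b<..} \<noteq> bot"
  by (auto simp: trivial_limit_within intro: islimpt_subset[OF islimpt_greaterThanLessThan1[of b c]])

lemma at_within_left_nontrivial:
  fixes b :: real
  shows "x0 < b \<Longrightarrow> b \<le> c \<Longrightarrow> at b within {x0..c} \<inter> {..<b} \<noteq> bot"
  by (auto simp: trivial_limit_within intro: islimpt_subset[OF islimpt_greaterThanLessThan2[of x0 b]])

section \<open>Constancy intervals and strict growth outside them\<close>

context
  fixes g :: "real \<Rightarrow> real"
  assumes g: "derivator g"
begin

text \<open>Monotonicity squeezes \<open>g\<close> between equal values on \<open>{a..b}\<close>;
  the radius is the distance from \<open>z\<close> to the nearer endpoint.\<close>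

lemma C_setI:
  assumes "g a = g b" "a < z" "z < b"
  shows "z \<in> C_set g"
proof -
  have *: "g y = g a" if "a \<le> y" "y \<le> b" for y
    using derivator_le[OF g that(1)] derivator_le[OF g that(2)] assms(1) by linarith
  have "g constant_on {z - min (z - a) (b - z)<..<z + min (z - a) (b - z)}"
    unfolding constant_on_def
  proof (intro exI[of _ "g a"] ballI)
    fix y assume "y \<in> {z - min (z - a) (b - z)<..<z + min (z - a) (b - z)}"
    then have "a \<le> y" "y \<le> b" by auto
    then show "g y = g a" by (rule *)
  qed
  moreover have "0 < min (z - a) (b - z)" using assms by simp
  ultimately show ?thesis unfolding C_set_def by (intro CollectI exI conjI)
qed

lemma C_setE:
  assumes "x \<in> C_set g"
  obtains \<epsilon> where "\<epsilon> > 0" "\<And>y. \<bar>y - x\<bar> < \<epsilon> \<Longrightarrow> g y = g x"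
proof -
  from assms obtain e k where e: "e > 0" "\<And>y. y \<in> {x - e<..<x + e} \<Longrightarrow> g y = k"
    unfolding C_set_def constant_on_def by blast
  then have "g y = g x" if "\<bar>y - x\<bar> < e" for y
  proof -
    have "x \<in> {x - e<..<x + e}" "y \<in> {x - e<..<x + e}"
      using that e(1) by (auto simp: abs_less_iff)
    then show ?thesis using e(2) by metis
  qed
  with e(1) show thesis by (rule that)
qed

lemma C_set_not_D: "x \<in> C_set g \<Longrightarrow> x \<notin> D_set g"
proof (erule C_setE)
  fix e :: real assume e: "e > 0" "\<And>y. \<bar>y - x\<bar> < e \<Longrightarrow> g y = g x"
  have "right_lim g x \<le> g (x + e / 2)"
    using e(1) by (intro right_lim_le g) auto
  also have "\<dots> = g x" by (rule e(2)) (use e(1) in simp)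
  finally show "x \<notin> D_set g" by (simp add: D_set_def jump_right_lim)
qed

lemma derivator_const_connected:
  assumes "connected K" "K \<subseteq> C_set g" "x \<in> K" "y \<in> K"
  shows "g x = g y"
proof (rule connected_local_const[OF assms(1,3,4)])
  show "\<forall>a\<in>K. \<forall>\<^sub>F b in at a within K. g a = g b"
  proof
    fix a assume "a \<in> K"
    with assms(2) have "a \<in> C_set g" by auto
    then obtain e where "e > 0" "\<And>y. \<bar>y - a\<bar> < e \<Longrightarrow> g y = g a"
      by (rule C_setE) blast
    then show "\<forall>\<^sub>F b in at a within K. g a = g b"
      unfolding eventually_at dist_real_def by metis
  qed
qed

text \<open>Left continuity carries the constant value on \<open>K\<close> to the least upper bound
  of \<open>K\<close>, which may lie outside \<open>K\<close>.\<close>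

lemma derivator_lub_connected:
  assumes K: "connected K" "K \<subseteq> C_set g" "k \<in> K"
    and b: "\<And>k. k \<in> K \<Longrightarrow> k \<le> b" "\<And>z. z < b \<Longrightarrow> \<exists>k\<in>K. z < k"
  shows "g k = g b"
proof (cases "k = b")
  case False
  with b(1) K have kb: "k < b" by force
  have "eventually (\<lambda>z. g z = g k) (at_left b)"
    using eventually_at_left_real[OF kb]
  proof eventually_elim
    case (elim z)
    then obtain k' where "k' \<in> K" "z < k'" using b(2) by auto
    then have "z \<in> K"
      using elim K connected_contains_Icc[of K k k'] by auto
    then show ?case using K by (intro derivator_const_connected[OF K(1,2)])
  qed
  then have "(g \<longlongrightarrow> g k) (at_left b)"
    by (rule tendsto_eventually)
  with derivator_left[OF g] show ?thesis
    by (rule tendsto_unique[rotated, symmetric]) auto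
qed auto

text \<open>At the greatest lower bound \<open>g\<close> may jump, so the constant value on
  \<open>K\<close> is identified with the right limit instead.\<close>

lemma derivator_glb_connected:
  assumes K: "connected K" "K \<subseteq> C_set g" "k \<in> K"
    and b: "\<And>k. k \<in> K \<Longrightarrow> b \<le> k" "\<And>z. b < z \<Longrightarrow> \<exists>k\<in>K. k < z" "b \<notin> C_set g"
  shows "g k = right_lim g b"
proof -
  have "k \<noteq> b" using K b(3) by auto
  with b(1)[OF K(3)] have kb: "b < k" by simp
  have "eventually (\<lambda>z. g z = g k) (at_right b)"
    using eventually_at_right_real[OF kb]
  proof eventually_elim
    case (elim z)
    then obtain k' where "k' \<in> K" "k' < z" using b(2) by auto
    then have "z \<in> K"
      using elim K connected_contains_Icc[of K k' k] by auto
    then show ?case using K by (intro derivator_const_connected[OF K(1,2)])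
  qed
  then have "(g \<longlongrightarrow> g k) (at_right b)"
    by (rule tendsto_eventually)
  with derivator_right[OF g] show ?thesis
    by (rule tendsto_unique[rotated, symmetric]) auto
qed

text \<open>The constancy interval ending at \<open>x\<close> already has the value
  \<open>g x\<close>; equality with \<open>g y\<close> would extend it across \<open>x\<close> and
  put \<open>x\<close> into \<open>C_set g\<close>. Strictness keeps the denominators of the
  one-sided quotients nonzero.\<close>

lemma N_plus_less:
  assumes "ereal x \<in> N_plus g" "x \<notin> C_set g" "x < y"
  shows "g x < g y"
proof (rule ccontr)
  assume "\<not> g x < g y"
  then have eq: "g x = g y" using derivator_le[OF g, of x y] assms by simp
  from assms(1) obtain K where K: "K \<in> components (C_set g)" "Sup (ereal ` K) = ereal x"
    unfolding N_plus_def by auto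
  then have "K \<noteq> {}" "connected K" "K \<subseteq> C_set g"
    by (auto dest: in_components_nonempty in_components_connected in_components_subset)
  moreover from this K(2) have ub: "\<And>k. k \<in> K \<Longrightarrow> k \<le> x" "\<And>z. z < x \<Longrightarrow> \<exists>k\<in>K. z < k"
    by (simp_all add: Sup_ereal_image_iff)
  ultimately obtain k where k: "k \<in> K" "k \<le> x" "g k = g x" and KC: "K \<subseteq> C_set g"
    using derivator_lub_connected[OF _ _ _ ub] by blast
  moreover have "k \<noteq> x" using k assms(2) KC by auto
  ultimately show False
    using C_setI[of k y x] eq assms by auto
qed

text \<open>Mirror image of the previous argument: membership in \<open>N_minus g\<close> excludes a
  jump at \<open>x\<close>, so the constancy interval starting there has the value
  \<open>g x\<close>.\<close>

lemma N_minus_less: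
  assumes "ereal x \<in> N_minus g" "x \<notin> C_set g" "y < x"
  shows "g y < g x"
proof (rule ccontr)
  assume "\<not> g y < g x"
  then have eq: "g y = g x" using derivator_le[OF g, of y x] assms by simp
  have D: "x \<notin> D_set g" using assms(1) by (auto simp: N_minus_def)
  from assms(1) obtain K where K: "K \<in> components (C_set g)" "Inf (ereal ` K) = ereal x"
    unfolding N_minus_def by auto
  then have "K \<noteq> {}" "connected K" "K \<subseteq> C_set g"
    by (auto dest: in_components_nonempty in_components_connected in_components_subset)
  moreover from this K(2) have lb: "\<And>k. k \<in> K \<Longrightarrow> x \<le> k" "\<And>z. x < z \<Longrightarrow> \<exists>k\<in>K. k < z"
    by (simp_all add: Inf_ereal_image_iff)
  ultimately obtain k where k: "k \<in> K" "x \<le> k" "g k = right_lim g x" and KC: "K \<subseteq> C_set g"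
    using derivator_glb_connected[OF _ _ _ lb assms(2)] by blast
  moreover have "k \<noteq> x" using k assms(2) KC by auto
  ultimately show False
    using C_setI[of y k x] eq assms right_lim_not_D[OF g D] by auto
qed

lemma component_of_Ioo:
  assumes "g x = g y" "x < y"
  obtains K where "K \<in> components (C_set g)" "{x<..<y} \<subseteq> K"
proof -
  have sub: "{x<..<y} \<subseteq> C_set g"
    using C_setI[OF assms(1)] by auto
  have mid: "(x + y) / 2 \<in> {x<..<y}" using assms(2) by auto
  show thesis
  proof
    show "connected_component_set (C_set g) ((x + y) / 2) \<in> components (C_set g)"
      using sub mid by (intro componentsI) auto
    show "{x<..<y} \<subseteq> connected_component_set (C_set g) ((x + y) / 2)"
      using sub mid by (intro connected_component_maximal) auto
  qed
qed

text \<open>If \<open>g x = g y\<close>, the open interval lies in a component of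
  \<open>C_set g\<close>. As \<open>x\<close> is outside \<open>C_set g\<close>, that component
  cannot reach to the left of \<open>x\<close>, so \<open>x\<close> is its left endpoint and would
  belong to \<open>N_minus g\<close>.\<close>

lemma not_N_minus_less:
  assumes "ereal x \<notin> N_minus g" "x \<notin> C_set g" "x \<notin> D_set g" "x < y"
  shows "g x < g y"
proof (rule ccontr)
  assume "\<not> g x < g y"
  then have "g x = g y" using derivator_le[OF g, of x y] assms by simp
  then obtain K where K: "K \<in> components (C_set g)" "{x<..<y} \<subseteq> K"
    using assms(4) by (rule component_of_Ioo)
  then have KC: "connected K" "K \<subseteq> C_set g" "K \<noteq> {}"
    by (auto dest: in_components_nonempty in_components_connected in_components_subset)
  have mid: "(x + y) / 2 \<in> K" using K(2) assms(4) by auto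
  have "Inf (ereal ` K) = ereal x"
    unfolding Inf_ereal_image_iff[OF KC(3)]
  proof safe
    fix k assume "k \<in> K"
    show "x \<le> k"
    proof (rule ccontr)
      assume "\<not> x \<le> k"
      then have "x \<in> K"
        using connected_contains_Icc[OF KC(1) \<open>k \<in> K\<close> mid] assms(4) by auto
      with KC assms show False by auto
    qed
  next
    fix z assume "x < z"
    show "\<exists>k\<in>K. k < z"
    proof
      show "(x + min y z) / 2 \<in> K" using K(2) assms(4) \<open>x < z\<close> by (auto simp: min_def)
      show "(x + min y z) / 2 < z" using assms(4) \<open>x < z\<close> by (auto simp: min_def)
    qed
  qed
  with K assms show False by (auto simp: N_minus_def)
qed

lemma not_N_plus_less:
  assumes "ereal x \<notin> N_plus g" "x \<notin> C_set g" "x \<notin> D_set g" "y < x"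
  shows "g y < g x"
proof (rule ccontr)
  assume "\<not> g y < g x"
  then have "g y = g x" using derivator_le[OF g, of y x] assms by simp
  then obtain K where K: "K \<in> components (C_set g)" "{y<..<x} \<subseteq> K"
    using assms(4) by (rule component_of_Ioo)
  then have KC: "connected K" "K \<subseteq> C_set g" "K \<noteq> {}"
    by (auto dest: in_components_nonempty in_components_connected in_components_subset)
  have mid: "(y + x) / 2 \<in> K" using K(2) assms(4) by auto
  have "Sup (ereal ` K) = ereal x"
    unfolding Sup_ereal_image_iff[OF KC(3)]
  proof safe
    fix k assume "k \<in> K"
    show "k \<le> x"
    proof (rule ccontr)
      assume "\<not> k \<le> x"
      then have "x \<in> K"
        using connected_contains_Icc[OF KC(1) mid \<open>k \<in> K\<close>] assms(4) by auto
      with KC assms show False by auto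
    qed
  next
    fix z assume "z < x"
    show "\<exists>k\<in>K. z < k"
    proof
      show "(x + max y z) / 2 \<in> K" using K(2) assms(4) \<open>z < x\<close> by (auto simp: max_def)
      show "z < (x + max y z) / 2" using assms(4) \<open>z < x\<close> by (auto simp: max_def)
    qed
  qed
  with K assms show False by (auto simp: N_plus_def)
qed

text \<open>The component of \<open>x\<close> stays below \<open>c\<close>, which is outside
  \<open>C_set g\<close>, and its supremum is not \<open>c\<close>, which is neither in
  \<open>N_plus g\<close> nor a jump. Thus the base point has room to its right, and maximality of
  the component forces growth beyond it.\<close>

lemma g_base_C_set:
  assumes x: "x \<in> C_set g" "x \<le> c" and c: "c \<notin> D_set g" "ereal c \<notin> N_plus g" "c \<notin> C_set g"
  shows "x \<le> g_base g x" "g_base g x < c" "g (g_base g x) = g x"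
    "\<And>y. g_base g x < y \<Longrightarrow> g (g_base g x) < g y"
proof -
  define K where "K = connected_component_set (C_set g) x"
  define b where "b = Sup K"
  have base: "g_base g x = b" using x by (simp add: g_base_def b_def K_def)
  have K: "connected K" "K \<subseteq> C_set g" "x \<in> K" "K \<in> components (C_set g)"
    using x(1) by (auto simp: K_def connected_component_subset componentsI)
  have kc: "k < c" if "k \<in> K" for k
  proof (rule ccontr)
    assume "\<not> k < c"
    then have "c \<in> K" using connected_contains_Icc[OF K(1,3) that] x(2) by auto
    with K c show False by auto
  qed
  then have bdd: "bdd_above K" by (meson bdd_aboveI less_imp_le)
  have b: "\<And>k. k \<in> K \<Longrightarrow> k \<le> b" "\<And>z. z < b \<Longrightarrow> \<exists>k\<in>K. z < k"
    using bdd K(3) less_cSup_iff[of K] by (auto simp: b_def intro: cSup_upper)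
  show "x \<le> g_base g x" using b(1) K(3) by (simp add: base)
  have eq: "g k = g b" if "k \<in> K" for k
    by (rule derivator_lub_connected[OF K(1,2) that b])
  show "g (g_base g x) = g x" using eq[OF K(3)] by (simp add: base)
  have "b \<le> c" unfolding b_def using kc K(3) by (intro cSup_least) (auto intro: less_imp_le)
  moreover have "b \<noteq> c"
  proof
    assume "b = c"
    then have "Sup (ereal ` K) = ereal c"
      using b K(3) by (subst Sup_ereal_image_iff) auto
    with K(4) c show False by (auto simp: N_plus_def)
  qed
  ultimately show "g_base g x < c" by (simp add: base)
  fix y assume y: "g_base g x < y"
  show "g (g_base g x) < g y"
  proof (rule ccontr)
    assume "\<not> g (g_base g x) < g y"
    then have "g x = g y"
      using derivator_le[OF g, of b y] eq[OF K(3)] y by (simp add: base)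
    \<comment> \<open>A further flat stretch would enlarge the component past its supremum
      \<open>b\<close>.\<close>
    then have "{x..<y} \<subseteq> C_set g"
      using C_setI[of x y] x(1) by (auto simp: le_less)
    then have "{x..<y} \<subseteq> K"
      unfolding K_def using y b(1)[OF K(3)] by (intro connected_component_maximal) (auto simp: base)
    then have "(b + y) / 2 \<in> K"
      using y b(1)[OF K(3)] by (auto simp: base)
    from b(1)[OF this] y show False by (simp add: base)
  qed
qed

section \<open>Limits of the difference quotients from remainder bounds\<close>

lemma g_continuous_on_tendsto:
  fixes W :: "real \<Rightarrow> 'a::real_normed_field"
  assumes "g_continuous_on g S W" "x \<in> S" "x \<notin> D_set g"
  shows "(W \<longlongrightarrow> W x) (at x within S)"
proof (rule tendstoI)
  fix e :: real assume "e > 0"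
  with assms obtain d where d: "d > 0" "\<And>y. y \<in> S \<Longrightarrow> \<bar>g y - g x\<bar> < d \<Longrightarrow> norm (W y - W x) < e"
    unfolding g_continuous_on_def by blast
  have "eventually (\<lambda>y. dist (g y) (g x) < d) (at x within S)"
    by (rule tendstoD[OF derivator_tendsto[OF g assms(3)] d(1)])
  moreover have "eventually (\<lambda>y. y \<in> S) (at x within S)"
    by (simp add: eventually_at_filter)
  ultimately show "eventually (\<lambda>y. dist (W y) (W x) < e) (at x within S)"
    by eventually_elim (use d in \<open>auto simp: dist_norm\<close>)
qed

context
  fixes x0 c :: real and F \<phi> :: "real \<Rightarrow> 'a::real_normed_field" and W :: "real \<Rightarrow> real"
  assumes c: "c \<notin> D_set g" "ereal c \<notin> N_plus g" "c \<notin> C_set g"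
    and x0: "x0 < c" "ereal x0 \<notin> N_minus g"
    and W_mono: "mono_on {x0..c} W" and W_cont: "g_continuous_on g {x0..c} W"
    and \<phi>_cont: "g_continuous_on g {x0..c} \<phi>"
    and rem_right: "\<And>x y. x0 \<le> x \<Longrightarrow> x < y \<Longrightarrow> y \<le> c \<Longrightarrow>
      norm (F y - F x - \<phi> x * of_real (g y - g x)) \<le> (W y - W x) * (g y - right_lim g x)"
    and rem_left: "\<And>x y. x0 \<le> x \<Longrightarrow> x < y \<Longrightarrow> y \<le> c \<Longrightarrow>
      norm (F y - F x - \<phi> y * of_real (g y - g x)) \<le> (W y - W x) * (g y - g x)"
begin

text \<open>By \<open>rem_right\<close> the error is at most \<open>W y - W b\<close> times the
  ratio of the masses of the open and the half-open interval. At a jump the ratio tends to 0 while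
  \<open>W y - W b\<close> stays bounded; otherwise the ratio is 1 and \<open>W y\<close> tends to
  \<open>W b\<close>.\<close>

lemma quotient_tendsto_right:
  assumes b: "b \<in> {x0..c}" and less: "\<And>y. b < y \<Longrightarrow> y \<le> c \<Longrightarrow> g b < g y"
  shows "((\<lambda>y. (F y - F b) / of_real (g y - g b)) \<longlongrightarrow> \<phi> b) (at b within {x0..c} \<inter> {b<..})"
proof (rule LIM_zero_cancel)
  let ?F = "at b within {x0..c} \<inter> {b<..}"
  have in_F: "eventually (\<lambda>y. b < y \<and> y \<le> c) ?F"
    by (simp add: eventually_at_filter)
  have gpos: "0 < g y - g b" if "b < y \<and> y \<le> c" for y
    using less that by simp
  have bound: "norm ((F y - F b) / of_real (g y - g b) - \<phi> b)
      \<le> (W y - W b) * (g y - right_lim g b) / (g y - g b)" if y: "b < y \<and> y \<le> c" for y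
  proof -
    have "(F y - F b) / of_real (g y - g b) - \<phi> b
        = (F y - F b - \<phi> b * of_real (g y - g b)) / of_real (g y - g b)"
      using less[of y] y by (simp add: diff_divide_distrib flip: of_real_diff)
    then have "norm ((F y - F b) / of_real (g y - g b) - \<phi> b)
        = norm (F y - F b - \<phi> b * of_real (g y - g b)) / (g y - g b)"
      using less[of y] y by (simp add: norm_divide flip: of_real_diff)
    also have "\<dots> \<le> (W y - W b) * (g y - right_lim g b) / (g y - g b)"
      using less[of y] y b by (intro divide_right_mono rem_right) auto
    finally show ?thesis .
  qed
  show "((\<lambda>y. (F y - F b) / of_real (g y - g b) - \<phi> b) \<longlongrightarrow> 0) ?F"
  proof (cases "b \<in> D_set g")
    case True
    show ?thesis
    proof (rule Lim_null_comparison)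
      have gr: "(g \<longlongrightarrow> right_lim g b) ?F"
        by (rule tendsto_within_subset[OF derivator_right[OF g]]) auto
      have "((\<lambda>y. (W c - W b) * (g y - right_lim g b) / (g y - g b))
          \<longlongrightarrow> (W c - W b) * (right_lim g b - right_lim g b) / (right_lim g b - g b)) ?F"
        using True by (intro tendsto_intros gr) (simp add: D_set_def jump_right_lim)
      then show "((\<lambda>y. (W c - W b) * (g y - right_lim g b) / (g y - g b)) \<longlongrightarrow> 0) ?F"
        by simp
      show "eventually (\<lambda>y. norm ((F y - F b) / of_real (g y - g b) - \<phi> b)
          \<le> (W c - W b) * (g y - right_lim g b) / (g y - g b)) ?F"
        using in_F
      proof eventually_elim
        case (elim y)
        have "W y \<le> W c" using elim b by (intro mono_onD[OF W_mono]) auto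
        then have "(W y - W b) * (g y - right_lim g b) / (g y - g b)
            \<le> (W c - W b) * (g y - right_lim g b) / (g y - g b)"
          using elim gpos[OF elim] right_lim_le[OF g, of b y]
          by (intro divide_right_mono mult_right_mono) auto
        with bound[OF elim] show ?case by linarith
      qed
    qed
  next
    case False
    show ?thesis
    proof (rule Lim_null_comparison)
      have "(W \<longlongrightarrow> W b) ?F"
        by (rule tendsto_within_subset[OF g_continuous_on_tendsto[OF W_cont b False]]) auto
      then show "((\<lambda>y. W y - W b) \<longlongrightarrow> 0) ?F"
        by (rule LIM_zero)
      show "eventually (\<lambda>y. norm ((F y - F b) / of_real (g y - g b) - \<phi> b) \<le> W y - W b) ?F"
        using in_F
      proof eventually_elim
        case (elim y)
        then show ?case
          using bound[OF elim] gpos[OF elim] by (simp add: right_lim_not_D[OF g False])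
      qed
    qed
  qed
qed

text \<open>Here \<open>b\<close> is the right end, so \<open>rem_left\<close> bounds the error by
  \<open>W b - W y\<close>, which tends to 0 because \<open>W\<close> is \<open>g\<close>-continuous
  and \<open>b\<close> is no jump.\<close>

lemma quotient_tendsto_left:
  assumes b: "b \<in> {x0..c}" "b \<notin> D_set g" and less: "\<And>y. y < b \<Longrightarrow> x0 \<le> y \<Longrightarrow> g y < g b"
  shows "((\<lambda>y. (F y - F b) / of_real (g y - g b)) \<longlongrightarrow> \<phi> b) (at b within {x0..c} \<inter> {..<b})"
proof (rule LIM_zero_cancel, rule Lim_null_comparison)
  let ?F = "at b within {x0..c} \<inter> {..<b}"
  have "(W \<longlongrightarrow> W b) ?F"
    by (rule tendsto_within_subset[OF g_continuous_on_tendsto[OF W_cont b]]) auto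
  then show "((\<lambda>y. W b - W y) \<longlongrightarrow> 0) ?F"
    by (auto intro!: tendsto_eq_intros)
  have "eventually (\<lambda>y. x0 \<le> y \<and> y < b) ?F"
    by (simp add: eventually_at_filter)
  then show "eventually (\<lambda>y. norm ((F y - F b) / of_real (g y - g b) - \<phi> b) \<le> W b - W y) ?F"
  proof eventually_elim
    case (elim y)
    have gp: "0 < g b - g y" using less elim by simp
    have "(F y - F b) / of_real (g y - g b) = (F b - F y) / of_real (g b - g y)"
      by (metis minus_diff_eq minus_divide_divide of_real_minus)
    also have "\<dots> - \<phi> b = (F b - F y - \<phi> b * of_real (g b - g y)) / of_real (g b - g y)"
      using gp by (simp add: diff_divide_distrib flip: of_real_diff)
    finally have "norm ((F y - F b) / of_real (g y - g b) - \<phi> b)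
        = norm (F b - F y - \<phi> b * of_real (g b - g y)) / (g b - g y)"
      using gp by (simp add: norm_divide flip: of_real_diff)
    also have "\<dots> \<le> (W b - W y) * (g b - g y) / (g b - g y)"
      using elim b gp by (intro divide_right_mono rem_left) auto
    also have "\<dots> = W b - W y" using gp by simp
    finally show ?case .
  qed
qed

text \<open>The cases follow \<open>g_filter\<close>. The hypotheses on \<open>x0\<close> and
  \<open>c\<close> guarantee that every prescribed one-sided filter is proper within
  \<open>{x0..c}\<close>.\<close>

lemma g_quotient_tendsto:
  assumes x: "x \<in> {x0..c}"
  shows "(g_quotient g F x \<longlongrightarrow> \<phi> x) (g_filter g x0 c x)" "g_filter g x0 c x \<noteq> bot"
proof -
  have "(g_quotient g F x \<longlongrightarrow> \<phi> x) (g_filter g x0 c x) \<and> g_filter g x0 c x \<noteq> bot"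
  proof (cases "x \<in> C_set g")
    case True
    define b where "b = g_base g x"
    have b: "x \<le> b" "b < c" "g b = g x" "\<And>y. b < y \<Longrightarrow> g b < g y"
      unfolding b_def using g_base_C_set[OF True _ c] x by auto
    \<comment> \<open>The limit is computed at the base point, but a \<open>g\<close>-continuous
      function cannot distinguish \<open>b\<close> from \<open>x\<close>, as
      \<open>g b = g x\<close>.\<close>
    have "\<phi> b = \<phi> x"
    proof (rule ccontr)
      assume "\<phi> b \<noteq> \<phi> x"
      then have "norm (\<phi> b - \<phi> x) > 0" by simp
      then obtain d where "d > 0" and
        d: "\<forall>y\<in>{x0..c}. \<bar>g y - g x\<bar> < d \<longrightarrow> norm (\<phi> y - \<phi> x) < norm (\<phi> b - \<phi> x)"
        using \<phi>_cont x unfolding g_continuous_on_def by blast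
      then show False using bspec[OF d, of b] b(1-3) x by auto
    qed
    then show ?thesis
      using True b x quotient_tendsto_right[of b] at_within_right_nontrivial[of x0 b c]
      by (simp add: g_filter_def g_quotient_def[abs_def] flip: b_def)
  next
    case nC: False
    then have base: "g_base g x = x" by (simp add: g_base_def)
    show ?thesis
    proof (cases "x \<in> D_set g")
      case True
      have "g x < g y" if "x < y" for y
        using right_lim_le[OF g that] True by (simp add: D_set_def jump_right_lim)
      moreover have "x < c" using x True c by (cases "x = c") auto
      ultimately show ?thesis
        using True x quotient_tendsto_right[of x] at_within_right_nontrivial[of x0 x c]
        by (simp add: g_filter_def g_quotient_def[abs_def] base)
    next
      case nD: False
      consider (p) "ereal x \<in> N_plus g" | (m) "ereal x \<notin> N_plus g" "ereal x \<in> N_minus g"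
        | (n) "ereal x \<notin> N_plus g" "ereal x \<notin> N_minus g"
        by blast
      then show ?thesis
      proof cases
        case p
        then have "x < c" using x c by (cases "x = c") auto
        with p show ?thesis
          using nC nD x quotient_tendsto_right[of x] at_within_right_nontrivial[of x0 x c]
          by (simp add: g_filter_def g_quotient_def[abs_def] base N_plus_less)
      next
        case m
        then have "x0 < x" using x x0 by (cases "x = x0") auto
        with m show ?thesis
          using nC nD x quotient_tendsto_left[of x] at_within_left_nontrivial[of x0 x c]
          by (simp add: g_filter_def g_quotient_def[abs_def] base N_minus_less)
      next
        case n
        \<comment> \<open>Outside all exceptional sets the two one-sided limits are glued; at
          \<open>x0\<close> or \<open>c\<close> one of the two sides is empty.\<close>
        have "((\<lambda>y. (F y - F x) / of_real (g y - g x)) \<longlongrightarrow> \<phi> x)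
            (at x within {x0..c} \<inter> {x<..} \<union> {x0..c} \<inter> {..<x})"
          using x nD not_N_minus_less[OF n(2) nC nD] not_N_plus_less[OF n(1) nC nD]
          by (intro Lim_Un quotient_tendsto_left quotient_tendsto_right) auto
        moreover have "at x within {x0..c} \<inter> {x<..} \<union> {x0..c} \<inter> {..<x} = at x within {x0..c}"
          by (rule at_within_nhd[of _ UNIV]) auto
        moreover have "at x within {x0..c} \<noteq> bot"
          using x x0 by (simp add: trivial_limit_within islimpt_Icc)
        ultimately show ?thesis
          using n nC nD by (simp add: g_filter_def g_quotient_def[abs_def] base)
      qed
    qed
  qed
  then show "(g_quotient g F x \<longlongrightarrow> \<phi> x) (g_filter g x0 c x)" "g_filter g x0 c x \<noteq> bot"
    by auto
qed

end

end

section \<open>Linear equations with constant coefficients\<close>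

theorem theorem5p20:
  fixes g :: "real \<Rightarrow> real" and x0 c :: real and m :: nat
    and lam cs a :: "nat \<Rightarrow> 'a::{real_normed_field, banach}" and r :: "nat \<Rightarrow> real"
    and f :: "real \<Rightarrow> real" and v :: "real \<Rightarrow> 'a"
  assumes "derivator g"
    and "\<infinity> \<notin> N_plus g"
    and "m \<ge> 1"
    and "\<And>n. a (n + m) * fact (n + m)
           = (\<Sum>k<m. lam k * a (n + k) * fact (n + k)) + of_real (r n) * fact n"
    and "\<And>k. k < m \<Longrightarrow> a k * fact k = cs k"
    and "c > x0"
    and "\<And>x. x \<in> {x0..c} \<Longrightarrow> summable (\<lambda>n. \<bar>r n * g_monomial g x0 n x\<bar>)"
    and "\<And>x. x \<in> {x0..c} \<Longrightarrow> f x = (\<Sum>n. r n * g_monomial g x0 n x)"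
    and "ereal x0 \<notin> N_minus g"
    and "c \<notin> D_set g" and "ereal c \<notin> N_plus g" and "c \<notin> C_set g"
    and "\<And>x. x \<in> {x0..c} \<Longrightarrow> v x = (\<Sum>n. a n * of_real (g_monomial g x0 n x))"
  shows "(\<forall>x\<in>{x0..c}. summable (\<lambda>n. norm (a n * of_real (g_monomial g x0 n x))))
    \<and> v \<in> g_Ck g x0 c m
    \<and> (\<forall>x\<in>{x0..c}. (g_deriv g x0 c ^^ m) v x
          = (\<Sum>k<m. lam k * (g_deriv g x0 c ^^ k) v x) + of_real (f x))
    \<and> (\<forall>k<m. (g_deriv g x0 c ^^ k) v x0 = cs k)"
proof -
  note g = assms(1) and rec = assms(4) and init = assms(5) and x0c = assms(6)
  define A where "A n = a n * fact n" for n
  define V where "V k x = (\<Sum>n. A (n + k) * of_real (g_pow g x0 n x))" for k x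
  define T where "T n = (\<Sum>k<m. norm (A (n + k)))" for n
  define \<rho> where "\<rho> n = \<bar>r n\<bar> * fact n" for n
  define L where "L = (\<Sum>k<m. norm (lam k))"

  \<comment> \<open>Bounds and summability for the coefficients\<close>
  have A_rec: "A (n + m) = (\<Sum>k<m. lam k * A (n + k)) + of_real (r n * fact n)" for n
    using rec[of n] by (simp add: A_def mult.assoc)
  have A_le_T: "norm (A (n + k)) \<le> T n" if "k < m" for n k
    unfolding T_def using that by (intro member_le_sum) auto
  have A_m: "norm (A (n + m)) \<le> L * T n + \<rho> n" for n
  proof -
    have "norm (A (n + m)) \<le> (\<Sum>k<m. norm (lam k * A (n + k))) + norm (of_real (r n * fact n) :: 'a)"
      unfolding A_rec by (rule norm_triangle_le) (intro add_mono norm_sum order_refl)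
    also have "(\<Sum>k<m. norm (lam k * A (n + k))) \<le> (\<Sum>k<m. norm (lam k) * T n)"
      unfolding norm_mult by (intro sum_mono mult_left_mono A_le_T) auto
    also have "norm (of_real (r n * fact n) :: 'a) = \<rho> n"
      unfolding norm_of_real by (simp add: \<rho>_def abs_mult)
    finally show ?thesis by (simp add: L_def sum_distrib_right)
  qed
  have monomial: "a n * of_real (g_monomial g x0 n x) = A n * of_real (g_pow g x0 n x)" for n x
    by (simp add: A_def g_pow_def)
  have forcing: "r n * g_monomial g x0 n x = r n * fact n * g_pow g x0 n x" for n x
    by (simp add: g_pow_def)
  have sum_\<rho>: "summable (\<lambda>n. \<rho> n * g_pow g x0 n c)"
    using assms(7)[of c] x0c g_pow_nonneg[OF g, of x0 c]
    by (simp add: forcing abs_mult \<rho>_def)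
  have sum_T: "summable (\<lambda>n. T n * g_pow g x0 n c)"
  proof (rule g_pow_gronwall[OF g])
    \<comment> \<open>Shifting the window adds \<open>norm (A (n + m))\<close>, which
      \<open>A_m\<close> bounds. The constant \<open>1 + L\<close> is positive even if all
      \<open>lam k\<close> vanish.\<close>
    show "T (Suc n) \<le> (1 + L) * T n + \<rho> n" for n
    proof -
      have "T (Suc n) \<le> (\<Sum>k<Suc m. norm (A (n + k)))"
        unfolding T_def sum.lessThan_Suc_shift by simp
      also have "\<dots> \<le> T n + (L * T n + \<rho> n)"
        using A_m[of n] by (simp add: T_def)
      finally show ?thesis by (simp add: algebra_simps)
    qed
    show "0 < 1 + L"
      unfolding L_def by (intro add_pos_nonneg sum_nonneg) auto
  qed (use x0c sum_\<rho> in \<open>auto simp: T_def \<rho>_def intro!: sum_nonneg\<close>)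
  \<comment> \<open>The range includes \<open>k = m\<close>: below \<open>m\<close> the coefficient
    lies in the window of \<open>T n\<close>, while at \<open>m\<close> the bound \<open>A_m\<close>
    brings in the forcing term.\<close>
  have sum_A: "summable (\<lambda>n. norm (A (n + k)) * g_pow g x0 n c)" if "k \<le> m" for k
  proof (rule summable_comparison_test')
    show "summable (\<lambda>n. (1 + L) * (T n * g_pow g x0 n c) + \<rho> n * g_pow g x0 n c)"
      by (intro summable_add summable_mult sum_T sum_\<rho>)
    show "norm (norm (A (n + k)) * g_pow g x0 n c)
        \<le> (1 + L) * (T n * g_pow g x0 n c) + \<rho> n * g_pow g x0 n c" if "0 \<le> n" for n
    proof -
      have nn: "0 \<le> T n" "0 \<le> L" "0 \<le> \<rho> n"
        by (auto simp: T_def L_def \<rho>_def intro: sum_nonneg)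
      have "norm (A (n + k)) \<le> (1 + L) * T n + \<rho> n"
      proof (cases "k = m")
        case True
        then show ?thesis using A_m[of n] nn(1) by (simp add: distrib_right)
      next
        case False
        then have "norm (A (n + k)) \<le> T n" using \<open>k \<le> m\<close> by (intro A_le_T) simp
        then show ?thesis
          using nn(3) mult_nonneg_nonneg[OF nn(2,1)] unfolding distrib_right by linarith
      qed
      then have "norm (A (n + k)) * g_pow g x0 n c \<le> ((1 + L) * T n + \<rho> n) * g_pow g x0 n c"
        using x0c g by (intro mult_right_mono g_pow_nonneg) auto
      then show ?thesis
        using x0c g_pow_nonneg[OF g, of x0 c n] by (simp add: abs_mult algebra_simps)
    qed
  qed

  \<comment> \<open>The shifted series as iterated derivatives\<close>
  have V_sums: "(\<lambda>n. A (n + k) * of_real (g_pow g x0 n x)) sums V k x" if "k \<le> m" "x \<in> {x0..c}" for k x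
    unfolding V_def using that by (intro summable_sums summable_g_pow_le[OF g sum_A]) auto
  have V_cont: "g_continuous_on g {x0..c} (V k)" if "k \<le> m" for k
    unfolding V_def[abs_def] by (rule g_pow_series_g_continuous[OF g sum_A[OF that]])
  have deriv: "g_differentiable g x0 c F x \<and> g_deriv g x0 c F x = V (Suc k) x"
    if k: "k < m" and F: "\<And>x. x \<in> {x0..c} \<Longrightarrow> F x = V k x" and x: "x \<in> {x0..c}" for F k x
  proof -
    define W where "W x = (\<Sum>n. norm (A (n + Suc k)) * g_pow g x0 n x)" for x
    have sum1: "summable (\<lambda>n. norm (A (n + k)) * g_pow g x0 n c)"
      and sum2: "summable (\<lambda>n. norm (A (n + Suc k)) * g_pow g x0 n c)"
      using k by (auto intro: sum_A simp del: add_Suc_right)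
    note remainder = g_pow_series_remainder[OF g, where A = "\<lambda>n. A (n + k)", unfolded add_Suc add_Suc_right[symmetric], OF sum1 sum2,
        folded V_def W_def]
    \<comment> \<open>Increments of \<open>W\<close> dominate the norms of increments of
      \<open>V (Suc k)\<close>, hence are nonnegative.\<close>
    have W_mono: "mono_on {x0..c} W"
    proof (rule mono_onI)
      fix y z assume "y \<in> {x0..c}" "z \<in> {x0..c}" "y \<le> z"
      then have "norm (V (Suc k) z - V (Suc k) y) \<le> W z - W y"
        unfolding V_def W_def by (intro g_pow_series_diff_le[OF g sum2]) auto
      then show "W y \<le> W z"
        using norm_ge_zero[of "V (Suc k) z - V (Suc k) y"] by linarith
    qed
    have W_cont: "g_continuous_on g {x0..c} W"
      using g_pow_series_g_continuous[OF g, of "\<lambda>n. norm (A (n + Suc k))" x0 c] sum2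
      by (simp add: W_def[abs_def] del: add_Suc_right)
    have rem_right: "norm (F z - F y - V (Suc k) y * of_real (g z - g y)) \<le> (W z - W y) * (g z - right_lim g y)"
      and rem_left: "norm (F z - F y - V (Suc k) z * of_real (g z - g y)) \<le> (W z - W y) * (g z - g y)"
      if "x0 \<le> y" "y < z" "z \<le> c" for y z
      using remainder[OF that] that F[of y] F[of z] by simp_all
    note lim = g_quotient_tendsto[OF g assms(10-12) x0c assms(9) W_mono W_cont V_cont[OF Suc_leI[OF k]]
        rem_right rem_left x]
    show ?thesis
      using lim unfolding g_differentiable_def g_deriv_def by (auto intro: tendsto_Lim)
  qed
  have v_V: "v x = V 0 x" if "x \<in> {x0..c}" for x
    using assms(13)[OF that] by (simp add: monomial V_def)
  have iter: "\<forall>x\<in>{x0..c}. (g_deriv g x0 c ^^ k) v x = V k x" if "k \<le> m" for k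
    using that
  proof (induction k)
    case (Suc k)
    then show ?case using deriv[of k "(g_deriv g x0 c ^^ k) v"] by auto
  qed (use v_V in simp)
  \<comment> \<open>\<open>k\<close> counts the derivatives already taken and \<open>j\<close> those
    still required, so both \<open>k\<close> and \<open>F\<close> vary in the induction.\<close>
  have Ck: "F \<in> g_Ck g x0 c j" if "k + j \<le> m" "\<And>x. x \<in> {x0..c} \<Longrightarrow> F x = V k x" for F k j
    using that
  proof (induction j arbitrary: k F)
    case 0
    then show ?case using V_cont[of k] by (simp add: g_continuous_on_def)
  next
    case (Suc j)
    have "g_continuous_on g {x0..c} F"
      using V_cont[of k] Suc.prems by (simp add: g_continuous_on_def)
    moreover have "g_deriv g x0 c F \<in> g_Ck g x0 c j"
      using Suc.prems deriv[of k F] by (intro Suc.IH[of "Suc k"]) auto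
    ultimately show ?case
      using Suc.prems deriv[of k F] by auto
  qed

  \<comment> \<open>The equation and the initial values\<close>
  have eq: "V m x = (\<Sum>k<m. lam k * V k x) + of_real (f x)" if x: "x \<in> {x0..c}" for x
  proof -
    have "summable (\<lambda>n. r n * g_monomial g x0 n x)"
      using assms(7)[OF x] by (rule summable_rabs_cancel)
    then have "(\<lambda>n. r n * fact n * g_pow g x0 n x) sums f x"
      using assms(8)[OF x] by (simp add: sums_iff forcing)
    then have "(\<lambda>n. of_real (r n * fact n * g_pow g x0 n x) :: 'a) sums of_real (f x)"
      by (rule sums_of_real)
    moreover have "(\<lambda>n. \<Sum>k<m. lam k * (A (n + k) * of_real (g_pow g x0 n x))) sums (\<Sum>k<m. lam k * V k x)"
      using x by (intro sums_sum sums_mult V_sums) auto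
    ultimately have "(\<lambda>n. (\<Sum>k<m. lam k * (A (n + k) * of_real (g_pow g x0 n x)))
        + of_real (r n * fact n * g_pow g x0 n x)) sums ((\<Sum>k<m. lam k * V k x) + of_real (f x))"
      by (intro sums_add)
    \<comment> \<open>The recurrence \<open>A_rec\<close>, multiplied by the monomial, identifies
      the combined series with that of \<open>V m\<close>.\<close>
    moreover have "(\<Sum>k<m. lam k * (A (n + k) * of_real (g_pow g x0 n x)))
        + of_real (r n * fact n * g_pow g x0 n x) = A (n + m) * of_real (g_pow g x0 n x)" for n
      by (simp add: A_rec distrib_right sum_distrib_right mult.assoc)
    ultimately show ?thesis
      using V_sums[of m x] x by (simp add: sums_iff)
  qed
  have V_x0: "V k x0 = cs k" if "k < m" for k
  proof -
    \<comment> \<open>Only the constant monomial survives at \<open>x0\<close>, which leaves the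
      coefficient \<open>A k\<close>.\<close>
    have "g_pow g x0 n x0 = 0" if "n \<noteq> 0" for n
      using that g by (cases n) auto
    then have "V k x0 = (\<Sum>n\<in>{0}. A (n + k) * of_real (g_pow g x0 n x0))"
      unfolding V_def by (intro suminf_finite) auto
    then show ?thesis
      using init[OF that] g by (simp add: A_def)
  qed
  have "summable (\<lambda>n. norm (a n * of_real (g_monomial g x0 n x)))" if "x \<in> {x0..c}" for x
    using that summable_g_pow_le(1)[OF g, where A = A and x = x and c = c] sum_A[of 0] g_pow_nonneg[OF g, of x0 x]
    by (simp add: monomial norm_mult)
  moreover have "v \<in> g_Ck g x0 c m"
    using Ck[of 0 m v] v_V by simp
  moreover have "(g_deriv g x0 c ^^ m) v x
      = (\<Sum>k<m. lam k * (g_deriv g x0 c ^^ k) v x) + of_real (f x)" if "x \<in> {x0..c}" for x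
    using iter that eq[OF that] by simp
  moreover have "(g_deriv g x0 c ^^ k) v x0 = cs k" if "k < m" for k
    using iter[of k] V_x0[OF that] that x0c by simp
  ultimately show ?thesis by blast
qed

end
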